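(* Let $m\le n$, let $A\in\mathbb{R}^{n\times n}$ be invertible, let $W,V\in\mathbb{R}^{n\times m}$ be full-rank matrices with $\det(W^{T}AV)\neq 0$, and let $x_0\in\mathbb{R}^n$. Let $Y$ be a real matrix with $n$ rows such that $\mathrm{Range}(Y)=\mathrm{Null}(W^{T}A)$ and let $G\ge 0$ be a symmetric positive semidefinite matrix of conformable size. Let $x^{\star}=x_0+Vv+YG^{1/2}\eta$, where $v$ (in $\mathbb{R}^m$) and $\eta$ are independent random vectors, $v$ has an arbitrary distribution, and $\eta\sim\mathcal{N}(0,I)$. Let $x\sim\mathcal{N}(x_0,VV^{T}+YGY^{T})$, and let $\widetilde{x}=x_0+V(W^{T}AV)^{-1}W^{T}(b-Ax_0)$ with $b=Ax^{\star}$. Then the posterior distribution is well-calibrated: 1. For $v_0\in\mathbb{R}^m$, the conditional distribution of $x$ given $W^{T}Ax=W^{T}(Ax_0+AVv_0)$ coincides with the conditional distribution of $x^{\star}$ given $v=v_0$. 2. $$\left\|x^{\star}-\widetilde{x}\right\|^{2}_{(YGY^{T})^{\dagger}}=\left(x^{\star}-\widetilde{x}\right)^{T}\left(YGY^{T}\right)^{\dagger}\left(x^{\star}-\widetilde{x}\right)\sim\chi^2_{n-m}.$$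
   Context: For $\mu\in\mathbb{R}^n$ and a symmetric positive semidefinite $\Sigma$ (possibly singular), $\mathcal{N}(\mu,\Sigma)$ denotes the (possibly degenerate) Gaussian distribution with mean $\mu$ and covariance $\Sigma$. $M^{\dagger}$ denotes the Moore–Penrose pseudoinverse, $G^{1/2}$ the symmetric positive semidefinite square root, and $I$ the identity matrix. $\chi^2_{k}$ is the chi-squared distribution with $k$ degrees of freedom. Conditioning of $x$ on $W^TAx$ is the usual conditioning of jointly Gaussian vectors. The vector $\widetilde{x}$ is the output of the projection method with initial guess $x_0$ and subspaces $\mathrm{Range}(V)$, $\mathrm{Range}(W)$ applied to the linear system with matrix $A$ and exact solution $x^{\star}$; "well-calibrated" means that items 1 and 2 hold.
   Formalization: Item 2 is proved under the added condition rank(YGY^T) = n−m, which is necessary and sufficient (automatic for positive definite G); without it the claim fails, e.g. for G = 0 and n > m, where the quadratic form is identically 0. *)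

theory Defs
  imports "HOL-Probability.Probability"
begin

definition psd :: "real^'n^'n \<Rightarrow> bool" where
  "psd S \<longleftrightarrow> transpose S = S \<and> (\<forall>x. 0 \<le> x \<bullet> (S *v x))"

text \<open>The symmetric positive semidefinite square root; meaningful only if the argument is \<open>psd\<close>.\<close>

definition psd_sqrt :: "real^'n^'n \<Rightarrow> real^'n^'n" where
  "psd_sqrt S = (THE R. psd R \<and> R ** R = S)"

text \<open>The Moore--Penrose pseudoinverse, given by the four Penrose conditions.\<close>

definition pinv :: "real^'n^'m \<Rightarrow> real^'m^'n" where
  "pinv M = (THE X. M ** X ** M = M \<and> X ** M ** X = X \<and>
                    transpose (M ** X) = M ** X \<and> transpose (X ** M) = X ** M)"

definition std_gaussian :: "(real^'n) measure" where
  "std_gaussian = density lborel (\<lambda>z. ennreal (\<Prod>i\<in>UNIV. std_normal_density (z $ i)))"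

text \<open>As an image measure, \<open>gaussian \<mu> \<Sigma>\<close> also covers singular covariances, where no Lebesgue
  density exists.\<close>

definition gaussian :: "real^'n \<Rightarrow> real^'n^'n \<Rightarrow> (real^'n) measure" where
  "gaussian \<mu> \<Sigma> = distr std_gaussian borel (\<lambda>z. \<mu> + psd_sqrt \<Sigma> *v z)"

text \<open>The law of the sum of squares of \<open>k\<close> independent standard normal variables. For
  \<open>k = 0\<close> it is the point mass at \<open>0\<close>.\<close>

definition chi_squared :: "nat \<Rightarrow> real measure" where
  "chi_squared k =
     distr (Pi\<^sub>M {..<k} (\<lambda>_. density lborel (\<lambda>t. ennreal (std_normal_density t)))) borel
       (\<lambda>z. \<Sum>i<k. (z i)\<^sup>2)"

text \<open>The library constant \<open>indep_var\<close> requires both variables to have the same value type;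
  this is its unfolding without that restriction.\<close>

definition indep_rvs :: "'a measure \<Rightarrow> ('a \<Rightarrow> 'x::topological_space) \<Rightarrow> ('a \<Rightarrow> 'y::topological_space) \<Rightarrow> bool"
where
  "indep_rvs M X Y \<longleftrightarrow> X \<in> borel_measurable M \<and> Y \<in> borel_measurable M \<and>
     prob_space.indep_set M {X -` B \<inter> space M |B. B \<in> sets borel}
                            {Y -` C \<inter> space M |C. C \<in> sets borel}"

text \<open>\<open>is_cond_distr M X Y \<kappa>\<close>: the kernel \<open>\<kappa>\<close> is a regular conditional distribution of \<open>X\<close>
  given \<open>Y\<close>, with \<open>\<kappa> y\<close> the conditional law of \<open>X\<close> given \<open>Y = y\<close>. This determines \<open>\<kappa>\<close> only up
  to null sets of the law of \<open>Y\<close>.\<close>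

definition is_cond_distr ::
  "'a measure \<Rightarrow> ('a \<Rightarrow> 'x::topological_space) \<Rightarrow> ('a \<Rightarrow> 'y::topological_space) \<Rightarrow> ('y \<Rightarrow> 'x measure) \<Rightarrow> bool"
where
  "is_cond_distr M X Y \<kappa> \<longleftrightarrow>
     X \<in> borel_measurable M \<and> Y \<in> borel_measurable M \<and>
     \<kappa> \<in> borel \<rightarrow>\<^sub>M prob_algebra borel \<and>
     (\<forall>B\<in>sets borel. \<forall>C\<in>sets borel.
        emeasure M {\<omega>\<in>space M. X \<omega> \<in> B \<and> Y \<omega> \<in> C} =
        (\<integral>\<^sup>+y\<in>C. emeasure (\<kappa> y) B \<partial>distr M borel Y))"

text \<open>The usual (everywhere defined) version of the conditional distribution of
  \<open>x \<sim> \<N>(\<mu>, \<Sigma>)\<close> given the jointly Gaussian vector \<open>B x = y\<close>. Here \<open>\<Sigma> B\<^sup>T\<close> is the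
  cross-covariance of \<open>x\<close> and \<open>B x\<close>, and \<open>B \<Sigma> B\<^sup>T\<close> the covariance of \<open>B x\<close>.\<close>

definition gaussian_cond ::
  "real^'n \<Rightarrow> real^'n^'n \<Rightarrow> real^'n^'m \<Rightarrow> real^'m \<Rightarrow> (real^'n) measure"
where
  "gaussian_cond \<mu> \<Sigma> B y =
     (let K = \<Sigma> ** transpose B ** pinv (B ** \<Sigma> ** transpose B)
      in gaussian (\<mu> + K *v (y - B *v \<mu>)) (\<Sigma> - K ** B ** \<Sigma>))"

end

theory Submission
  imports Defs
begin

text \<open>
  Put \<open>L = Y G\<^sup>1\<^sup>/\<^sup>2\<close>, \<open>B = W\<^sup>T A\<close> and \<open>C = B V\<close>. The vector \<open>L z\<close>, for a standard Gaussian \<open>z\<close> of any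
  dimension, has law \<open>N(0, L L\<^sup>T)\<close>, so the prior \<open>x\<close> is distributed as \<open>x\<^sub>0 + V z\<^sub>1 + L z\<^sub>2\<close> with
  independent standard \<open>z\<^sub>1\<close>, \<open>z\<^sub>2\<close>. Since \<open>B L = 0\<close> and \<open>C\<close> is invertible, observing \<open>B x\<close> amounts
  to observing \<open>z\<^sub>1\<close>, and the conditional law is that of \<open>x\<^sub>0 + V z\<^sub>1 + L z\<^sub>2\<close> with \<open>z\<^sub>1\<close> frozen;
  the Kalman gain is \<open>V C\<^sup>-\<^sup>1\<close> and the posterior covariance is \<open>L L\<^sup>T\<close>. For the same reason the
  projection method recovers the \<open>V v\<close> part exactly and its error is \<open>L \<eta>\<close>. In an orthonormal
  eigenbasis of \<open>L L\<^sup>T\<close>, the pseudoinverse turns the squared norm of the error into a sum of as many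
  squared independent standard normals as \<open>L L\<^sup>T\<close> has nonzero eigenvalues.
\<close>

section \<open>The standard Gaussian measure\<close>

lemma distr_lborel_orthogonal_transformation:
  fixes f :: "'a::euclidean_space \<Rightarrow> 'a"
  assumes f: "orthogonal_transformation f"
  shows "distr lborel borel f = lborel"
proof (rule measure_eqI)
  define \<mu> where "\<mu> = distr lborel borel f"
  define B where "B = ball (0::'a) 1"
  have linf: "linear f" and normf: "\<And>x. norm (f x) = norm x"
    using f by (auto simp: orthogonal_transformation)
  have f_meas[measurable]: "f \<in> borel_measurable borel"
    using linf by (intro borel_measurable_continuous_onI linear_continuous_on linear_conv_bounded_linear[THEN iffD1])
  have sets_\<mu>[measurable_cong]: "sets \<mu> = sets borel" and space_\<mu>[simp]: "space \<mu> = UNIV"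
    by (simp_all add: \<mu>_def)
  have surjf: "surj f" using f by (rule orthogonal_transformation_surj)
  \<comment> \<open>Translating by \<open>a = f c\<close> after \<open>f\<close> is the same as
    translating by \<open>c\<close> before it, and \<open>lborel\<close> absorbs the latter.\<close>
  have \<mu>_plus: "distr \<mu> borel ((+) a) = \<mu>" for a
  proof -
    obtain c where c: "a = f c" using surjf by blast
    have "distr \<mu> borel ((+) a) = distr lborel borel (\<lambda>x. f (c + x))"
      unfolding \<mu>_def by (subst distr_distr) (auto simp: o_def c linear_add[OF linf])
    also have "\<dots> = distr (distr lborel borel ((+) c)) borel f"
      by (subst distr_distr) (auto simp: o_def)
    finally show ?thesis by (simp add: lborel_distr_plus \<mu>_def)
  qed
  have lborel_minus: "distr lborel borel (\<lambda>x. a - x) = lborel" for a :: 'a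
    using lborel_affine[of "-1" a] by (simp add: density_1)
  \<comment> \<open>Fubini below requires sigma-finiteness. The inverse of \<open>f\<close> carries
    \<open>\<mu>\<close> back to \<open>lborel\<close>, and sigma-finiteness of an image measure
    passes to the measure itself.\<close>
  interpret \<mu>: sigma_finite_measure \<mu>
  proof -
    have "inj f" using f by (rule orthogonal_transformation_inj)
    obtain g where g: "linear g" "\<And>x. g (f x) = x" "\<And>x. f (g x) = x"
      by (metis linf linear_injective_isomorphism \<open>inj f\<close>)
    have [measurable]: "g \<in> borel_measurable borel"
      using g(1) by (intro borel_measurable_continuous_onI linear_continuous_on linear_conv_bounded_linear[THEN iffD1])
    have "sigma_finite_measure (distr \<mu> borel g)"
    proof -
      have "distr \<mu> borel g = lborel"
        unfolding \<mu>_def by (subst distr_distr) (auto simp: o_def g distr_id2)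
      then show ?thesis using sigma_finite_lborel by simp
    qed
    then show "sigma_finite_measure \<mu>"
      by (rule sigma_finite_measure_distr) measurable
  qed
  txt \<open>Uniqueness of Haar measure: two translation-invariant measures are proportional, by Fubini.
    The unit ball, which \<open>f\<close> preserves, fixes the constant.\<close>
  have swap: "emeasure lborel B * emeasure \<mu> E = emeasure \<mu> B * emeasure lborel E"
    if [measurable]: "E \<in> sets borel" for E
  proof -
    have [measurable]: "B \<in> sets borel" by (simp add: B_def)
    have B1: "(\<integral>\<^sup>+y. indicator B (x + y) \<partial>lborel) = emeasure lborel B" for x
    proof -
      have "emeasure lborel B = (\<integral>\<^sup>+y. indicator B y \<partial>distr lborel borel ((+) x))"
        by (simp add: lborel_distr_plus)
      also have "\<dots> = (\<integral>\<^sup>+y. indicator B (x + y) \<partial>lborel)"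
        by (subst nn_integral_distr) auto
      finally show ?thesis by simp
    qed
    have E1: "(\<integral>\<^sup>+y. indicator E (x - y) \<partial>lborel) = emeasure lborel E" for x
    proof -
      have "emeasure lborel E = (\<integral>\<^sup>+y. indicator E y \<partial>distr lborel borel (\<lambda>y. x - y))"
        by (simp add: lborel_minus)
      also have "\<dots> = (\<integral>\<^sup>+y. indicator E (x - y) \<partial>lborel)"
        by (subst nn_integral_distr) auto
      finally show ?thesis by simp
    qed
    \<comment> \<open>Translation by \<open>y\<close> under \<open>\<mu>\<close> moves the shift
      from \<open>B\<close> to \<open>E\<close>.\<close>
    have M1: "(\<integral>\<^sup>+x. indicator E x * indicator B (x + y) \<partial>\<mu>) =
              (\<integral>\<^sup>+x. indicator B x * indicator E (x - y) \<partial>\<mu>)" for y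
    proof -
      have "(\<integral>\<^sup>+x. indicator B x * indicator E (x - y) \<partial>\<mu>)
          = (\<integral>\<^sup>+x. indicator B x * indicator E (x - y) \<partial>distr \<mu> borel ((+) y))"
        by (simp add: \<mu>_plus)
      also have "\<dots> = (\<integral>\<^sup>+x. indicator B (y + x) * indicator E (y + x - y) \<partial>\<mu>)"
        by (subst nn_integral_distr) auto
      finally show ?thesis by (simp add: algebra_simps)
    qed
    interpret pair_sigma_finite \<mu> "lborel :: 'a measure" by standard
    have "emeasure lborel B * emeasure \<mu> E = (\<integral>\<^sup>+x. indicator E x * emeasure lborel B \<partial>\<mu>)"
      by (simp add: nn_integral_multc mult.commute)
    also have "\<dots> = (\<integral>\<^sup>+x. (\<integral>\<^sup>+y. indicator E x * indicator B (x + y) \<partial>lborel) \<partial>\<mu>)"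
      by (simp add: nn_integral_cmult B1)
    also have "\<dots> = (\<integral>\<^sup>+y. (\<integral>\<^sup>+x. indicator E x * indicator B (x + y) \<partial>\<mu>) \<partial>lborel)"
      by (rule Fubini'[symmetric]) measurable
    also have "\<dots> = (\<integral>\<^sup>+y. (\<integral>\<^sup>+x. indicator B x * indicator E (x - y) \<partial>\<mu>) \<partial>lborel)"
      by (simp add: M1)
    also have "\<dots> = (\<integral>\<^sup>+x. (\<integral>\<^sup>+y. indicator B x * indicator E (x - y) \<partial>lborel) \<partial>\<mu>)"
      by (rule Fubini') measurable
    also have "\<dots> = (\<integral>\<^sup>+x. indicator B x * emeasure lborel E \<partial>\<mu>)"
      by (simp add: nn_integral_cmult E1)
    also have "\<dots> = emeasure \<mu> B * emeasure lborel E"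
      by (simp add: nn_integral_multc)
    finally show ?thesis .
  qed
  fix E assume "E \<in> sets (distr lborel borel f)"
  then have E: "E \<in> sets borel" by simp
  have "emeasure \<mu> B = emeasure lborel B"
    unfolding \<mu>_def by (subst emeasure_distr) (auto simp: B_def normf vimage_def intro!: arg_cong[where f="emeasure lborel"])
  moreover have "emeasure lborel B \<noteq> 0" "emeasure lborel B \<noteq> \<infinity>"
    unfolding B_def using content_ball_pos[of 1 "0::'a"] emeasure_lborel_ball_finite[of "0::'a" 1] 
    by (auto simp: measure_def less_top)
  ultimately show "emeasure (distr lborel borel f) E = emeasure lborel E"
    using swap[OF E] unfolding \<mu>_def[symmetric]
    by (simp add: ennreal_mult_cancel_left)
qed simp

section \<open>Coordinates of a standard Gaussian vector\<close>

lemma sets_std_gaussian[simp, measurable_cong]: "sets std_gaussian = sets borel"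
  by (simp add: std_gaussian_def)

lemma space_std_gaussian[simp]: "space std_gaussian = UNIV"
  by (simp add: std_gaussian_def)

lemma measurable_matrix_vector_mult[measurable (raw)]:
  fixes A :: "real^'n^'m"
  assumes [measurable]: "f \<in> borel_measurable M"
  shows "(\<lambda>w. A *v f w) \<in> borel_measurable M"
  by (rule borel_measurable_continuous_on[OF _ assms]) (intro linear_continuous_on linear_conv_bounded_linear[THEN iffD1] matrix_vector_mul_linear)

lemma measurable_vec_lambda[measurable (raw)]:
  fixes f :: "'n::finite \<Rightarrow> 'a \<Rightarrow> real"
  assumes [measurable]: "\<And>i. f i \<in> borel_measurable M"
  shows "(\<lambda>w. \<chi> i. f i w) \<in> borel_measurable M"
proof -
  have "(\<lambda>w. (\<chi> i. f i w) \<bullet> b) \<in> borel_measurable M" if "b \<in> Basis" for b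
    using that by (auto simp: Basis_vec_def inner_axis)
  then show ?thesis by (subst borel_measurable_euclidean_space) blast
qed

lemma measurable_vec_nth_comp[measurable (raw)]:
  fixes f :: "'a \<Rightarrow> real^'n"
  assumes "f \<in> borel_measurable M"
  shows "(\<lambda>w. f w $ i) \<in> borel_measurable M"
  by (rule borel_measurable_continuous_on[OF _ assms]) (intro continuous_intros)

lemma prob_space_std_normal: "prob_space std_normal_distribution"
  by (rule prob_space_normal_density) simp

text \<open>The density is a product over the coordinates. Absorbing the indicator of the box into
  the factors leaves an integral that \<open>lborel\<close> splits into one-dimensional
  ones.\<close>

lemma emeasure_std_gaussian_box:
  fixes E :: "'n::finite \<Rightarrow> real set"
  assumes [measurable]: "\<And>i. E i \<in> sets borel"
  shows "emeasure std_gaussian {z. \<forall>i. z $ i \<in> E i} = (\<Prod>i\<in>UNIV. emeasure std_normal_distribution (E i))"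
proof -
  \<comment> \<open>The product formula for \<open>lborel\<close> runs over \<open>Basis\<close>;
    \<open>ax\<close> identifies the index type with the standard basis vectors.\<close>
  define ax where "ax = (\<lambda>i::'n. axis i (1::real))"
  have inj: "inj ax" by (auto simp: ax_def inj_def axis_eq_axis)
  have Basis: "(Basis :: (real^'n) set) = range ax"
    by (auto simp: Basis_vec_def ax_def)
  define F where "F b x = ennreal (std_normal_density x) * indicator (E (inv ax b)) x" for b x
  have F_ax: "F (ax i) = (\<lambda>x. ennreal (std_normal_density x) * indicator (E i) x)" for i
    by (auto simp: F_def inj)
  have "emeasure std_gaussian {z. \<forall>i. z $ i \<in> E i} =
      (\<integral>\<^sup>+z. (\<Prod>i\<in>UNIV. ennreal (std_normal_density (z $ i))) * indicator {z. \<forall>i. z $ i \<in> E i} z \<partial>lborel)"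
    unfolding std_gaussian_def by (subst emeasure_density) (auto simp: prod_ennreal)
  also have "\<dots> = (\<integral>\<^sup>+z. (\<Prod>b\<in>Basis. F b (z \<bullet> b)) \<partial>lborel)"
  proof (intro nn_integral_cong)
    fix z :: "real^'n"
    have "(\<Prod>b\<in>Basis. F b (z \<bullet> b)) = (\<Prod>i\<in>UNIV. F (ax i) (z $ i))"
      unfolding Basis by (subst prod.reindex[OF inj]) (simp add: ax_def inner_axis)
    also have "\<dots> = (\<Prod>i\<in>UNIV. ennreal (std_normal_density (z $ i))) * (\<Prod>i\<in>UNIV. indicator (E i) (z $ i))"
      by (simp add: F_ax prod.distrib)
    also have "(\<Prod>i\<in>UNIV. indicator (E i) (z $ i)) = (indicator {z. \<forall>i. z $ i \<in> E i} z :: ennreal)"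
      by (cases "\<forall>i. z $ i \<in> E i") (auto simp: indicator_def intro!: prod_zero)
    finally show "(\<Prod>i\<in>UNIV. ennreal (std_normal_density (z $ i))) * indicator {z. \<forall>i. z $ i \<in> E i} z
        = (\<Prod>b\<in>Basis. F b (z \<bullet> b))" by simp
  qed
  also have "\<dots> = (\<Prod>b\<in>Basis. (\<integral>\<^sup>+x. F b x \<partial>lborel))"
    by (rule nn_integral_lborel_prod) (auto simp: F_def)
  also have "\<dots> = (\<Prod>i\<in>UNIV. emeasure std_normal_distribution (E i))"
    unfolding Basis by (subst prod.reindex[OF inj]) (simp add: F_ax emeasure_density)
  finally show ?thesis .
qed

lemma prob_space_std_gaussian: "prob_space std_gaussian"
proof
  show "emeasure std_gaussian (space std_gaussian) = 1"
    using emeasure_std_gaussian_box[of "\<lambda>_. UNIV"]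
      prob_space.emeasure_space_1[OF prob_space_std_normal] by simp
qed

text \<open>Boxes with Borel sides are stable under intersection and generate the Borel sets, so a
  law is recognised as standard Gaussian by its values on them.\<close>

lemma std_gaussian_eqI:
  fixes \<mu> :: "(real^'n) measure"
  assumes sets: "sets \<mu> = sets borel"
    and box: "\<And>E. (\<And>i. E i \<in> sets borel) \<Longrightarrow>
      emeasure \<mu> {z. \<forall>i. z $ i \<in> E i} = (\<Prod>i\<in>UNIV. emeasure std_normal_distribution (E i))"
  shows "\<mu> = std_gaussian"
proof (rule measure_eqI_generator_eq[where \<Omega>=UNIV and A="\<lambda>_. UNIV"
      and E="{{z. \<forall>i. z $ i \<in> E i} |E. \<forall>i. E i \<in> sets borel}"])
  let ?\<E> = "{{z::real^'n. \<forall>i. z $ i \<in> E i} |E. \<forall>i. E i \<in> sets borel}"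
  show "Int_stable ?\<E>"
  proof (rule Int_stableI)
    fix a b assume "a \<in> ?\<E>" "b \<in> ?\<E>"
    then obtain E F where "a = {z. \<forall>i. z $ i \<in> E i}" "b = {z. \<forall>i. z $ i \<in> F i}"
      "\<forall>i. E i \<in> sets borel" "\<forall>i. F i \<in> sets borel" by blast
    then show "a \<inter> b \<in> ?\<E>"
      by (intro CollectI exI[of _ "\<lambda>i. E i \<inter> F i"]) auto
  qed
  have borel: "sets (borel :: (real^'n) measure) = sigma_sets UNIV ?\<E>"
  proof
    have 1: "box a b \<in> sigma_sets UNIV ?\<E>" for a b
      by (rule sigma_sets.Basic, rule CollectI, rule exI[of _ "\<lambda>i. {a $ i<..<b $ i}"]) (auto simp: mem_box_cart)
    show "sets (borel :: (real^'n) measure) \<subseteq> sigma_sets UNIV ?\<E>"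
    proof -
      have "sets (borel :: (real^'n) measure) = sigma_sets UNIV (range (\<lambda>(a, b). box a b))"
        by (subst borel_eq_box) simp
      also have "\<dots> \<subseteq> sigma_sets UNIV ?\<E>"
        by (rule sigma_sets_mono) (clarsimp simp only: 1 ball_simps split_paired_all prod.case)
      finally show ?thesis .
    qed
    have "{z. \<forall>i. z $ i \<in> E i} \<in> sets (borel :: (real^'n) measure)" if "\<forall>i. E i \<in> sets borel" for E
    proof -
      have [measurable]: "E i \<in> sets borel" for i using that by blast
      show ?thesis by measurable
    qed
    then show "sigma_sets UNIV ?\<E> \<subseteq> sets (borel :: (real^'n) measure)"
      by (intro sets.sigma_sets_subset[of _ borel, simplified]) auto
  qed
  show "sets \<mu> = sigma_sets UNIV ?\<E>" "sets std_gaussian = sigma_sets UNIV ?\<E>"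
    using borel sets by simp_all
  show "emeasure \<mu> X = emeasure std_gaussian X" if "X \<in> ?\<E>" for X
    using that box by (auto simp: emeasure_std_gaussian_box)
  show "range (\<lambda>_::nat. UNIV::(real^'n) set) \<subseteq> ?\<E>" 
    by (auto intro!: exI[of _ "\<lambda>_. UNIV"])
  show "emeasure \<mu> UNIV \<noteq> \<infinity>" for i :: nat
    using box[of "\<lambda>_. UNIV"] prob_space.emeasure_space_1[OF prob_space_std_normal] by simp
qed auto

text \<open>A coordinate left free contributes the total mass 1 to the product.\<close>

lemma emeasure_std_gaussian_box_subset:
  fixes E :: "'n::finite \<Rightarrow> real set"
  assumes "\<And>i. i \<in> J \<Longrightarrow> E i \<in> sets borel"
  shows "emeasure std_gaussian {z. \<forall>i\<in>J. z $ i \<in> E i} = (\<Prod>i\<in>J. emeasure std_normal_distribution (E i))"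
proof -
  let ?F = "\<lambda>i. if i \<in> J then E i else UNIV"
  have "emeasure std_gaussian {z. \<forall>i\<in>J. z $ i \<in> E i} = emeasure std_gaussian {z. \<forall>i. z $ i \<in> ?F i}"
    by (intro arg_cong[where f="emeasure std_gaussian"]) auto
  also have "\<dots> = (\<Prod>i\<in>UNIV. emeasure std_normal_distribution (?F i))"
    by (rule emeasure_std_gaussian_box) (use assms in auto)
  also have "\<dots> = (\<Prod>i\<in>J. emeasure std_normal_distribution (?F i))"
    using prob_space.emeasure_space_1[OF prob_space_std_normal]
    by (intro prod.mono_neutral_right) auto
  finally show ?thesis by simp
qed

text \<open>Injectivity makes the selected coordinates distinct, hence independent. Marginals and
  permutations are both covered.\<close>

lemma distr_std_gaussian_select:
  fixes h :: "'m::finite \<Rightarrow> 'n::finite"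
  assumes "inj h"
  shows "distr std_gaussian borel (\<lambda>z::real^'n. \<chi> i. z $ h i) = std_gaussian"
proof (rule std_gaussian_eqI)
  fix E :: "'m \<Rightarrow> real set" assume E[measurable]: "\<And>i. E i \<in> sets borel"
  have "emeasure (distr std_gaussian borel (\<lambda>z::real^'n. \<chi> i. z $ h i)) {z. \<forall>i. z $ i \<in> E i}
      = emeasure std_gaussian {z::real^'n. \<forall>j\<in>range h. z $ j \<in> E (inv h j)}"
    by (subst emeasure_distr) (auto simp: assms intro!: arg_cong[where f="emeasure std_gaussian"])
  also have "\<dots> = (\<Prod>i\<in>UNIV. emeasure std_normal_distribution (E i))"
    by (subst emeasure_std_gaussian_box_subset) (simp_all add: prod.reindex assms)
  finally show "emeasure (distr std_gaussian borel (\<lambda>z::real^'n. \<chi> i. z $ h i)) {z. \<forall>i. z $ i \<in> E i}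
      = (\<Prod>i\<in>UNIV. emeasure std_normal_distribution (E i))" .
qed simp

text \<open>The target is the function space in which \<open>chi_squared\<close> is defined: there
  the number of coordinates is a natural number, possibly 0, rather than a type.\<close>

lemma distr_std_gaussian_select_PiM:
  fixes h :: "nat \<Rightarrow> 'n::finite"
  assumes h: "inj_on h {..<r}"
  shows "distr std_gaussian (Pi\<^sub>M {..<r} (\<lambda>_. std_normal_distribution)) (\<lambda>z::real^'n. \<lambda>i\<in>{..<r}. z $ h i)
    = Pi\<^sub>M {..<r} (\<lambda>_. std_normal_distribution)"
proof -
  interpret prob_space std_normal_distribution by (rule prob_space_std_normal)
  interpret product_sigma_finite "\<lambda>_::nat. std_normal_distribution" by standard
  show ?thesis
  proof (rule PiM_eqI)
    fix E :: "nat \<Rightarrow> real set" assume "\<And>i. i \<in> {..<r} \<Longrightarrow> E i \<in> sets std_normal_distribution"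
    then have E: "\<And>i. i \<in> {..<r} \<Longrightarrow> E i \<in> sets borel" by simp
    have [measurable]: "(\<lambda>z::real^'n. \<lambda>i\<in>{..<r}. z $ h i) \<in> std_gaussian \<rightarrow>\<^sub>M (Pi\<^sub>M {..<r} (\<lambda>_. std_normal_distribution))"
      by (rule measurable_restrict) simp
    \<comment> \<open>\<open>g\<close> inverts \<open>h\<close> on its image, so that the condition
      on the selected entries can be indexed by the coordinates of \<open>z\<close>.\<close>
    define g where "g = the_inv_into {..<r} h"
    have g: "g (h i) = i" if "i \<in> {..<r}" for i
      unfolding g_def using h that by (rule the_inv_into_f_f)
    have "emeasure (distr std_gaussian (Pi\<^sub>M {..<r} (\<lambda>_. std_normal_distribution)) (\<lambda>z::real^'n. \<lambda>i\<in>{..<r}. z $ h i)) (Pi\<^sub>E {..<r} E)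
       = emeasure std_gaussian ((\<lambda>z::real^'n. \<lambda>i\<in>{..<r}. z $ h i) -` Pi\<^sub>E {..<r} E)"
      using E by (subst emeasure_distr) (auto intro!: sets_PiM_I_finite)
    also have "(\<lambda>z::real^'n. \<lambda>i\<in>{..<r}. z $ h i) -` Pi\<^sub>E {..<r} E = {z. \<forall>j\<in>h ` {..<r}. z $ j \<in> E (g j)}"
      by (intro set_eqI) (simp add: restrict_PiE_iff g del: restrict_PiE PiE_restrict)
    also have "emeasure std_gaussian \<dots> = (\<Prod>i<r. emeasure std_normal_distribution (E i))"
    proof (subst emeasure_std_gaussian_box_subset)
      show "E (g j) \<in> sets borel" if "j \<in> h ` {..<r}" for j
        using that by (elim imageE) (simp only: g E)
      show "(\<Prod>j\<in>h ` {..<r}. emeasure std_normal_distribution (E (g j))) = (\<Prod>i<r. emeasure std_normal_distribution (E i))"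
        by (subst prod.reindex[OF h], unfold o_def) (intro prod.cong refl, simp only: g)
    qed
    finally show "emeasure (distr std_gaussian (Pi\<^sub>M {..<r} (\<lambda>_. std_normal_distribution)) (\<lambda>z::real^'n. \<lambda>i\<in>{..<r}. z $ h i)) (Pi\<^sub>E {..<r} E)
        = (\<Prod>i\<in>{..<r}. emeasure std_normal_distribution (E i))" .
  qed simp_all
qed

lemma distr_std_gaussian_sum_squares:
  "distr std_gaussian borel (\<lambda>z::real^'n. \<Sum>i\<in>J. (z $ i)\<^sup>2) = chi_squared (card J)"
proof -
  obtain h where h: "bij_betw h {..<card J} J"
    using ex_bij_betw_nat_finite[of J] by (auto simp: atLeast0LessThan)
  then have inj: "inj_on h {..<card J}" by (simp add: bij_betw_def)
  have [measurable]: "(\<lambda>z::real^'n. \<lambda>i\<in>{..<card J}. z $ h i) \<in> std_gaussian \<rightarrow>\<^sub>M (Pi\<^sub>M {..<card J} (\<lambda>_. std_normal_distribution))"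
    by (rule measurable_restrict) simp
  have "chi_squared (card J) = distr std_gaussian borel (\<lambda>z::real^'n. \<Sum>i<card J. (z $ h i)\<^sup>2)"
    unfolding chi_squared_def
    by (subst distr_std_gaussian_select_PiM[OF inj, symmetric], subst distr_distr) (auto simp: o_def)
  also have "(\<lambda>z::real^'n. \<Sum>i<card J. (z $ h i)\<^sup>2) = (\<lambda>z::real^'n. \<Sum>i\<in>J. (z $ i)\<^sup>2)"
    by (rule ext) (rule sum.reindex_bij_betw[OF h])
  finally show ?thesis by simp
qed

text \<open>Indexing by the sum type keeps the added dimension a type, so that two independent
  standard Gaussian vectors can be treated as a single one.\<close>

definition vec_join :: "real^'m \<Rightarrow> real^'k \<Rightarrow> real^('m + 'k)" where
  "vec_join a b = (\<chi> i. case i of Inl p \<Rightarrow> a $ p | Inr q \<Rightarrow> b $ q)"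

lemma measurable_vec_join[measurable (raw)]:
  assumes [measurable]: "f \<in> borel_measurable M" "g \<in> borel_measurable M"
  shows "(\<lambda>w. vec_join (f w) (g w)) \<in> borel_measurable M"
  unfolding vec_join_def
proof (rule measurable_vec_lambda)
  fix i :: "'b + 'c"
  show "(\<lambda>w. case i of Inl p \<Rightarrow> f w $ p | Inr q \<Rightarrow> g w $ q) \<in> borel_measurable M"
    by (cases i) simp_all
qed

text \<open>A box in the joined space is a product of two boxes, and the product over the sum type
  splits accordingly.\<close>

lemma distr_std_gaussian_vec_join:
  "distr (std_gaussian \<Otimes>\<^sub>M std_gaussian) borel (\<lambda>(a, b). vec_join a b) =
    (std_gaussian :: (real^('m::finite + 'k::finite)) measure)"
proof (rule std_gaussian_eqI)
  fix E :: "'m + 'k \<Rightarrow> real set" assume E[measurable]: "\<And>i. E i \<in> sets borel"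
  interpret prob_space "std_gaussian :: (real^'k) measure" by (rule prob_space_std_gaussian)
  have [measurable]: "{z::real^'k. \<forall>q. z $ q \<in> E (Inr q)} \<in> sets borel" 
    "{z::real^'m. \<forall>q. z $ q \<in> E (Inl q)} \<in> sets borel" by measurable
  have "emeasure (distr (std_gaussian \<Otimes>\<^sub>M std_gaussian) borel (\<lambda>(a::real^'m, b::real^'k). vec_join a b)) {z. \<forall>i. z $ i \<in> E i}
      = emeasure (std_gaussian \<Otimes>\<^sub>M std_gaussian) ({z::real^'m. \<forall>p. z $ p \<in> E (Inl p)} \<times> {z::real^'k. \<forall>q. z $ q \<in> E (Inr q)})"
    by (subst emeasure_distr)
      (auto simp: space_pair_measure vec_join_def split: sum.splits intro!: arg_cong[where f="emeasure (std_gaussian \<Otimes>\<^sub>M std_gaussian)"])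
  also have "\<dots> = (\<Prod>p\<in>UNIV. emeasure std_normal_distribution (E (Inl p))) * (\<Prod>q\<in>UNIV. emeasure std_normal_distribution (E (Inr q)))"
    by (subst emeasure_pair_measure_Times) (simp_all add: emeasure_std_gaussian_box)
  also have "\<dots> = (\<Prod>i\<in>UNIV. emeasure std_normal_distribution (E i))"
    unfolding UNIV_sum by (subst prod.union_disjoint) (auto simp: prod.reindex)
  finally show "emeasure (distr (std_gaussian \<Otimes>\<^sub>M std_gaussian) borel (\<lambda>(a::real^'m, b::real^'k). vec_join a b)) {z. \<forall>i. z $ i \<in> E i}
      = (\<Prod>i\<in>UNIV. emeasure std_normal_distribution (E i))" .
qed simp

section \<open>Rotation invariance of the standard Gaussian\<close>

lemma std_gaussian_density_norm:
  "(\<Prod>i\<in>UNIV. std_normal_density (z $ i)) = (1 / sqrt (2 * pi)) ^ CARD('n) * exp (- (norm z)\<^sup>2 / 2)"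
  for z :: "real^'n"
proof -
  have "(\<Prod>i\<in>UNIV. std_normal_density (z $ i)) = (1 / sqrt (2 * pi)) ^ CARD('n) * exp (\<Sum>i\<in>UNIV. - (z $ i)\<^sup>2 / 2)"
    by (simp add: std_normal_density_def prod.distrib exp_sum prod_dividef power_one_over)
  also have "(\<Sum>i\<in>UNIV. - (z $ i)\<^sup>2 / 2) = - (norm z)\<^sup>2 / 2"
    by (simp add: norm_vec_def L2_set_def sum_nonneg sum_negf sum_divide_distrib[symmetric])
  finally show ?thesis .
qed

text \<open>The density depends only on the norm, and Lebesgue measure is invariant under orthogonal
  maps.\<close>

lemma distr_std_gaussian_orthogonal_matrix:
  fixes Q :: "real^'n^'n"
  assumes "orthogonal_matrix Q"
  shows "distr std_gaussian borel (\<lambda>z. Q *v z) = std_gaussian"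
proof -
  let ?d = "\<lambda>z::real^'n. ennreal (\<Prod>i\<in>UNIV. std_normal_density (z $ i))"
  have Q: "orthogonal_transformation ((*v) Q)"
    using assms orthogonal_transformation_matrix by (metis matrix_of_matrix_vector_mul matrix_vector_mul_linear)
  have "?d = ?d \<circ> (*v) Q"
    using orthogonal_transformation_norm[OF Q] by (auto simp: std_gaussian_density_norm)
  then have "distr std_gaussian borel (\<lambda>z. Q *v z) = distr (density lborel (?d \<circ> (*v) Q)) borel ((*v) Q)"
    by (simp add: std_gaussian_def)
  also have "\<dots> = density (distr lborel borel ((*v) Q)) ?d"
    unfolding o_def by (rule density_distr[symmetric]) measurable
  also have "\<dots> = std_gaussian"
    by (simp add: distr_lborel_orthogonal_transformation[OF Q] std_gaussian_def)
  finally show ?thesis .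
qed

section \<open>Symmetric matrices\<close>

lemma inner_matrix_vector_transpose:
  fixes A :: "real^'n^'m"
  shows "x \<bullet> (A *v y) = (transpose A *v x) \<bullet> y"
  by (simp add: dot_lmul_matrix)

lemma inner_symmetric_matrix:
  fixes S :: "real^'n^'n"
  assumes "transpose S = S"
  shows "x \<bullet> (S *v y) = (S *v x) \<bullet> y"
  by (metis assms inner_matrix_vector_transpose)

section \<open>Diagonal matrices and the spectral theorem\<close>

definition diag_mat :: "('n \<Rightarrow> real) \<Rightarrow> real^'n^'n" where
  "diag_mat d = (\<chi> i j. if i = j then d i else 0)"

lemma diag_mat_mult_vec: "(diag_mat d *v x) $ i = d i * x $ i"
  by (simp add: diag_mat_def matrix_vector_mult_def if_distrib[where f="\<lambda>t. t * _"] cong: if_cong)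

lemma diag_mat_mult: "diag_mat d ** diag_mat e = diag_mat (\<lambda>i. d i * e i)"
  by (simp add: diag_mat_def matrix_matrix_mult_def vec_eq_iff if_distrib[where f="\<lambda>t. t * _"] cong: if_cong)

lemma transpose_diag_mat [simp]: "transpose (diag_mat d) = diag_mat d"
  by (auto simp: diag_mat_def transpose_def vec_eq_iff)

lemma diag_mat_one: "diag_mat (\<lambda>_. 1) = mat 1"
  by (simp add: diag_mat_def mat_def)

text \<open>Adjoin an orthonormal basis \<open>C\<close> of the orthogonal complement
  \<open>T\<close> of the span; the two dimensions add up to that of the whole space.\<close>

lemma extend_orthonormal:
  fixes S :: "(real^'n) set"
  assumes S: "pairwise orthogonal S" "\<And>x. x \<in> S \<Longrightarrow> norm x = 1"
  obtains B where "S \<subseteq> B" "pairwise orthogonal B" "\<And>x. x \<in> B \<Longrightarrow> norm x = 1" "card B = CARD('n)"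
proof -
  have indep: "independent S"
    using S by (metis norm_zero pairwise_orthogonal_independent zero_neq_one)
  define T where "T = {y. \<forall>x\<in>span S. orthogonal x y}"
  have "subspace T"
    unfolding T_def by (auto simp: subspace_def orthogonal_def inner_add_right)
  then obtain C where C: "C \<subseteq> T" "pairwise orthogonal C" "\<And>x. x \<in> C \<Longrightarrow> norm x = 1" 
      "independent C" "card C = dim T"
    using orthonormal_basis_subspace by metis
  have orth: "orthogonal x y" if "x \<in> S" "y \<in> C" for x y
    using that C(1) by (auto simp: T_def span_base)
  have disj: "S \<inter> C = {}"
    using orth S(2) by (auto simp: orthogonal_self disjoint_iff)
      (metis norm_zero orthogonal_self zero_neq_one)
  show thesis
  proof
    show "pairwise orthogonal (S \<union> C)"
      using S(1) C(2) orth unfolding pairwise_def by (metis Un_iff orthogonal_commute)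
    have "dim T + dim (span S) = DIM(real^'n)"
      using dim_subspace_orthogonal_to_vectors[of "span S" UNIV] by (simp add: T_def)
    moreover have "dim (span S) = card S"
      using indep by (simp add: dim_eq_card_independent)
    ultimately show "card (S \<union> C) = CARD('n)"
      using disj indep C by (subst card_Un_disjoint) (auto simp: independent_imp_finite)
  qed (use S C in auto)
qed

text \<open>The orthogonal complement of \<open>B\<close> is nonzero and invariant under
  \<open>S\<close>. A maximizer of \<open>u \<bullet> (S *v u)\<close> on its unit sphere is an
  eigenvector, because the residual of the eigenvalue equation is itself an admissible
  direction.\<close>

lemma symmetric_eigenvector_orthogonal:
  fixes S :: "real^'n^'n"
  assumes S: "transpose S = S"
    and B: "\<And>x. x \<in> B \<Longrightarrow> \<exists>c. S *v x = c *\<^sub>R x" and "span B \<noteq> UNIV"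
  obtains u c where "norm u = 1" "\<And>x. x \<in> B \<Longrightarrow> orthogonal x u" "S *v u = c *\<^sub>R u"
proof -
  define T where "T = {y. \<forall>x\<in>B. orthogonal x y}"
  have T: "subspace T"
    unfolding T_def by (auto simp: subspace_def orthogonal_def inner_add_right)
  have ST: "S *v y \<in> T" if "y \<in> T" for y
  proof -
    have "x \<bullet> (S *v y) = 0" if "x \<in> B" for x
    proof -
      obtain c where "S *v x = c *\<^sub>R x" using B \<open>x \<in> B\<close> by blast
      then show ?thesis
        using \<open>y \<in> T\<close> \<open>x \<in> B\<close> by (simp add: inner_symmetric_matrix[OF S] T_def orthogonal_def)
    qed
    then show ?thesis by (simp add: T_def orthogonal_def)
  qed
  obtain w where w: "w \<noteq> 0" "\<And>y. y \<in> span B \<Longrightarrow> orthogonal w y"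
    using orthogonal_to_subspace_exists_gen[of B UNIV] \<open>span B \<noteq> UNIV\<close> by auto
  have "w \<in> T" using w by (auto simp: T_def span_base orthogonal_commute)
  then have "w /\<^sub>R norm w \<in> sphere 0 1 \<inter> T"
    using w(1) T by (auto simp: subspace_scale)
  moreover have "compact (sphere 0 1 \<inter> T)"
    by (intro compact_Int_closed compact_sphere closed_subspace T)
  moreover have "continuous_on (sphere 0 1 \<inter> T) (\<lambda>x. x \<bullet> (S *v x))"
    by (intro continuous_intros linear_continuous_on linear_conv_bounded_linear[THEN iffD1] matrix_vector_mul_linear)
  ultimately obtain u where u: "norm u = 1" "u \<in> T"
      and max: "\<And>y. norm y = 1 \<Longrightarrow> y \<in> T \<Longrightarrow> y \<bullet> (S *v y) \<le> u \<bullet> (S *v u)"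
    using continuous_attains_sup[of "sphere 0 1 \<inter> T" "\<lambda>x. x \<bullet> (S *v x)"]
    by (metis IntE IntI empty_iff mem_sphere_0)
  define c where "c = u \<bullet> (S *v u)"
  \<comment> \<open>Homogeneity extends the maximality on the unit sphere to an inequality on all of
    \<open>T\<close>.\<close>
  have le: "y \<bullet> (S *v y) \<le> c * (y \<bullet> y)" if "y \<in> T" for y
  proof (cases "y = 0")
    case False
    have "(y /\<^sub>R norm y) \<bullet> (S *v (y /\<^sub>R norm y)) \<le> c"
      unfolding c_def using False that T by (intro max) (auto simp: subspace_scale)
    then have "(y \<bullet> (S *v y)) / (norm y)\<^sup>2 \<le> c"
      by (simp add: matrix_vector_mult_scaleR power2_eq_square divide_inverse mult_ac)
    then show ?thesis
      using False by (simp add: divide_le_eq dot_square_norm)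
  qed simp
  define r where "r = S *v u - c *\<^sub>R u"
  have rT: "r \<in> T" using u ST T by (simp add: r_def subspace_diff subspace_scale)
  have uu: "u \<bullet> u = 1" using u by (simp add: norm_eq_1)
  have ru: "r \<bullet> u = 0" by (simp add: r_def inner_diff_left uu c_def inner_commute[of "S *v u"])
  have rr: "r \<bullet> (S *v u) = r \<bullet> r"
    using ru by (simp add: r_def inner_diff_right inner_commute)
  txt \<open>First-order optimality of the maximizer of the Rayleigh quotient, in the direction \<open>r\<close>.\<close>
  have quad: "2 * t * (r \<bullet> r) \<le> t\<^sup>2 * (c * (r \<bullet> r) - r \<bullet> (S *v r))" for t :: real
  proof -
    have "(u + t *\<^sub>R r) \<bullet> (S *v (u + t *\<^sub>R r)) \<le> c * ((u + t *\<^sub>R r) \<bullet> (u + t *\<^sub>R r))"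
      using u rT T by (intro le) (simp add: subspace_add subspace_scale)
    moreover have ur: "u \<bullet> (S *v r) = r \<bullet> r"
      by (metis inner_symmetric_matrix[OF S] inner_commute rr)
    moreover have "(u + t *\<^sub>R r) \<bullet> (S *v (u + t *\<^sub>R r))
        = u \<bullet> (S *v u) + t * (u \<bullet> (S *v r)) + t * (r \<bullet> (S *v u)) + t\<^sup>2 * (r \<bullet> (S *v r))"
      by (simp add: matrix_vector_right_distrib matrix_vector_mult_scaleR inner_add_left inner_add_right
          power2_eq_square algebra_simps)
    moreover have "(u + t *\<^sub>R r) \<bullet> (u + t *\<^sub>R r) = 1 + t\<^sup>2 * (r \<bullet> r)"
      by (simp add: inner_add_left inner_add_right uu ru inner_commute[of u r] power2_eq_square)
    ultimately have "c + 2 * (t * (r \<bullet> r)) + t\<^sup>2 * (r \<bullet> (S *v r)) \<le> c * (1 + t\<^sup>2 * (r \<bullet> r))"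
      by (simp add: rr ur c_def)
    then show ?thesis by (simp add: algebra_simps)
  qed
  have "r \<bullet> r = 0"
  proof (rule ccontr)
    assume "r \<bullet> r \<noteq> 0"
    then have pos: "r \<bullet> r > 0" by simp
    \<comment> \<open>\<open>k\<close> bounds the quadratic coefficient, and the summand 1 keeps it
      positive. The choice \<open>t = (r \<bullet> r) / k\<close> then makes the right-hand side of
      \<open>quad\<close> at most half of its left-hand side.\<close>
    define k where "k = \<bar>c * (r \<bullet> r) - r \<bullet> (S *v r)\<bar> + 1"
    have k: "k > 0" by (simp add: k_def)
    define t where "t = (r \<bullet> r) / k"
    have t: "t > 0" using pos k by (simp add: t_def)
    have "2 * t * (r \<bullet> r) \<le> t\<^sup>2 * k"
      using quad[of t] by (rule order_trans) (simp add: k_def mult_left_mono)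
    also have "\<dots> = t * (r \<bullet> r)"
      using k by (simp add: t_def power2_eq_square)
    finally show False using t pos by (simp add: mult_pos_pos)
  qed
  then have "S *v u = c *\<^sub>R u" by (simp add: r_def)
  then show thesis using u that by (auto simp: T_def)
qed

lemma orthogonal_matrix_of_orthonormal_basis:
  fixes f :: "'n \<Rightarrow> real^'n"
  assumes "\<And>i. norm (f i) = 1" "\<And>i j. i \<noteq> j \<Longrightarrow> orthogonal (f i) (f j)"
  shows "orthogonal_matrix (\<chi> i j. f i $ j)"
  using assms by (simp add: orthogonal_matrix_orthonormal_rows row_def)

text \<open>A largest orthonormal set of eigenvectors spans the space, since otherwise one more
  eigenvector orthogonal to it exists. These eigenvectors become the rows of
  \<open>Q\<close>.\<close>

theorem spectral_theorem_real_symmetric: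
  fixes S :: "real^'n^'n"
  assumes S: "transpose S = S"
  obtains Q d where "orthogonal_matrix Q" "S = transpose Q ** diag_mat d ** Q"
proof -
  define F where "F B \<longleftrightarrow> pairwise orthogonal B \<and> (\<forall>x\<in>B. norm x = 1) \<and> (\<forall>x\<in>B. \<exists>c. S *v x = c *\<^sub>R x)" for B
  have indep: "independent B" if "F B" for B
    using that by (intro pairwise_orthogonal_independent) (auto simp: F_def)
  have bound: "card B \<le> CARD('n)" if "F B" for B
    using independent_bound[OF indep[OF that]] by simp
  have "F {}" by (simp add: F_def)
  then obtain B where B: "F B" and max: "\<And>C. F C \<Longrightarrow> card C \<le> card B"
    using ex_has_greatest_nat[of F "{}" card "CARD('n) + 1"] bound by (metis less_Suc_eq_le Suc_eq_plus1)
  have "span B = UNIV"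
  proof (rule ccontr)
    assume "span B \<noteq> UNIV"
    then obtain u c where u: "norm u = 1" "\<And>x. x \<in> B \<Longrightarrow> orthogonal x u" "S *v u = c *\<^sub>R u"
      using symmetric_eigenvector_orthogonal[OF S, of B] B by (auto simp: F_def)
    have "u \<notin> B" using u(1) u(2)[of u] by (auto simp: orthogonal_self)
    have "F (insert u B)"
      using B u by (auto simp: F_def pairwise_insert orthogonal_commute)
    then have "card (insert u B) \<le> card B" by (rule max)
    then show False
      using \<open>u \<notin> B\<close> indep[OF B] by (simp add: independent_imp_finite)
  qed
  then have card: "card B = CARD('n)"
    using indep[OF B] by (metis DIM_cart DIM_real dim_UNIV dim_eq_card_independent dim_span mult.right_neutral)
  then obtain f :: "'n \<Rightarrow> real^'n" where f: "bij_betw f UNIV B"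
    using finite_same_card_bij[of "UNIV::'n set" B] indep[OF B] by (auto simp: independent_imp_finite)
  have fB: "f i \<in> B" for i using f by (auto simp: bij_betw_def)
  have "\<exists>d. \<forall>i. S *v f i = d i *\<^sub>R f i"
    using B fB by (intro choice) (auto simp: F_def)
  then obtain d where d: "\<And>i. S *v f i = d i *\<^sub>R f i" by blast
  define Q where "Q = (\<chi> i j. f i $ j)"
  have Q: "orthogonal_matrix Q"
    unfolding Q_def
  proof (rule orthogonal_matrix_of_orthonormal_basis)
    show "norm (f i) = 1" for i using B fB by (auto simp: F_def)
    show "orthogonal (f i) (f j)" if "i \<noteq> j" for i j
    proof -
      have "f i \<noteq> f j" using f that by (auto simp: bij_betw_def inj_def)
      then show ?thesis using B fB by (auto simp: F_def pairwise_def)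
    qed
  qed
  have "S ** transpose Q = transpose Q ** diag_mat d"
  proof -
    have "(S ** transpose Q) $ a $ i = (transpose Q ** diag_mat d) $ a $ i" for a i
    proof -
      have "(S ** transpose Q) $ a $ i = (S *v f i) $ a"
        by (simp add: matrix_matrix_mult_def matrix_vector_mult_def transpose_def Q_def)
      also have "\<dots> = (transpose Q ** diag_mat d) $ a $ i"
        unfolding d by (simp add: matrix_matrix_mult_def transpose_def Q_def diag_mat_def 
            if_distrib[where f="\<lambda>t. _ * t"] cong: if_cong)
      finally show ?thesis .
    qed
    then show ?thesis by (simp add: vec_eq_iff)
  qed
  then have "S ** (transpose Q ** Q) = transpose Q ** diag_mat d ** Q"
    by (simp add: matrix_mul_assoc)
  then show thesis
    using that Q by (simp add: orthogonal_matrix)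
qed

section \<open>Square roots and rank in an eigenbasis\<close>

locale orthogonal_conjugation =
  fixes Q :: "real^'n^'n"
  assumes Q: "orthogonal_matrix Q"
begin

text \<open>Matrices with this common eigenbasis multiply by multiplying their eigenvalues, so
  identities for roots, pseudoinverses and projections reduce to identities between real
  numbers.\<close>

definition conj_diag :: "('n \<Rightarrow> real) \<Rightarrow> real^'n^'n" where
  "conj_diag d = transpose Q ** diag_mat d ** Q"

lemma QQ: "Q ** transpose Q = mat 1" "transpose Q ** Q = mat 1"
  using Q by (simp_all add: orthogonal_matrix_def)

lemma conj_diag_mult: "conj_diag d ** conj_diag e = conj_diag (\<lambda>i. d i * e i)"
proof -
  have "conj_diag d ** conj_diag e = transpose Q ** diag_mat d ** (Q ** transpose Q) ** diag_mat e ** Q"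
    by (simp add: conj_diag_def matrix_mul_assoc)
  also have "\<dots> = transpose Q ** (diag_mat d ** diag_mat e) ** Q"
    by (simp add: QQ matrix_mul_assoc)
  finally show ?thesis by (simp add: diag_mat_mult conj_diag_def)
qed

lemma transpose_conj_diag [simp]: "transpose (conj_diag d) = conj_diag d"
  by (simp add: conj_diag_def matrix_transpose_mul matrix_mul_assoc)

lemma inner_conj_diag: "x \<bullet> (conj_diag d *v x) = (\<Sum>i\<in>UNIV. d i * ((Q *v x) $ i)\<^sup>2)"
proof -
  have "x \<bullet> (conj_diag d *v x) = (Q *v x) \<bullet> (diag_mat d *v (Q *v x))"
    by (simp add: conj_diag_def matrix_vector_mul_assoc[symmetric] inner_matrix_vector_transpose
        del: transpose_matrix_vector)
  then show ?thesis
    by (simp add: inner_vec_def diag_mat_mult_vec power2_eq_square mult_ac)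
qed

lemma conj_diag_nonneg_imp_psd: "(\<And>i. d i \<ge> 0) \<Longrightarrow> psd (conj_diag d)"
  by (simp add: psd_def inner_conj_diag sum_nonneg)

text \<open>The quadratic form at the eigenvector \<open>transpose Q *v axis i 1\<close> is the
  eigenvalue \<open>d i\<close>.\<close>

lemma psd_conj_diag_imp_nonneg:
  assumes "psd (conj_diag d)"
  shows "d i \<ge> 0"
proof -
  have "0 \<le> (transpose Q *v axis i 1) \<bullet> (conj_diag d *v (transpose Q *v axis i 1))"
    using assms unfolding psd_def by blast
  also have "\<dots> = (\<Sum>j\<in>UNIV. d j * (axis i 1 $ j)\<^sup>2)"
    unfolding inner_conj_diag
    by (simp add: matrix_vector_mul_assoc QQ del: transpose_matrix_vector)
  also have "\<dots> = (\<Sum>j\<in>UNIV. if j = i then d j else 0)"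
    by (intro sum.cong) (auto simp: axis_def)
  finally show ?thesis by simp
qed

text \<open>The definite description in \<open>psd_sqrt\<close> requires uniqueness. A root
  \<open>R\<close> is determined by its values on the eigenvectors \<open>f i\<close> of its
  square.\<close>

lemma psd_root_unique:
  assumes R: "psd R" and RR: "R ** R = conj_diag d" and d: "\<And>i. d i \<ge> 0"
  shows "R = conj_diag (\<lambda>i. sqrt (d i))"
proof -
  define f where "f i = transpose Q *v axis i 1" for i
  have Rt: "transpose R = R" using R by (simp add: psd_def)
  have f_nth: "f i $ a = Q $ i $ a" for i a
    by (simp add: f_def matrix_vector_mult_def axis_def transpose_def if_distrib cong: if_cong)
  have Sf: "conj_diag d *v f i = d i *\<^sub>R f i" for i
  proof -
    have "conj_diag d *v f i = transpose Q *v (diag_mat d *v ((Q ** transpose Q) *v axis i 1))"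
      by (simp add: conj_diag_def f_def matrix_vector_mul_assoc matrix_mul_assoc del: transpose_matrix_vector)
    also have "diag_mat d *v ((Q ** transpose Q) *v axis i 1) = d i *\<^sub>R axis i 1"
      by (simp add: QQ vec_eq_iff diag_mat_mult_vec axis_def)
    finally show ?thesis by (simp add: matrix_vector_mult_scaleR f_def del: transpose_matrix_vector)
  qed
  txt \<open>An eigenvector of \<open>R\<^sup>2\<close> for the eigenvalue \<open>d\<close> is one of \<open>R\<close> for \<open>sqrt d\<close>, because
    \<open>R + sqrt d\<close> annihilates \<open>R f - sqrt d f\<close>.\<close>
  have Rf: "R *v f i = sqrt (d i) *\<^sub>R f i" for i
  proof (cases "d i = 0")
    case True
    \<comment> \<open>For the eigenvalue 0 the squared norm of \<open>R *v f i\<close> is the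
      quadratic form of \<open>R ** R\<close> at \<open>f i\<close>, which vanishes.\<close>
    have "(R *v f i) \<bullet> (R *v f i) = f i \<bullet> (R *v (R *v f i))"
      by (rule inner_symmetric_matrix[OF Rt, symmetric])
    also have "\<dots> = 0"
      using Sf[of i] True by (simp add: matrix_vector_mul_assoc RR)
    finally show ?thesis using True by simp
  next
    case False
    then have pos: "sqrt (d i) > 0" using d[of i] by simp
    define w where "w = R *v f i - sqrt (d i) *\<^sub>R f i"
    have "R *v w + sqrt (d i) *\<^sub>R w = R *v (R *v f i) - (sqrt (d i) * sqrt (d i)) *\<^sub>R f i"
      by (simp add: w_def matrix_vector_mult_diff_distrib matrix_vector_mult_scaleR scaleR_diff_right)
    also have "\<dots> = 0"
      using Sf[of i] d[of i] by (simp add: matrix_vector_mul_assoc RR)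
    finally have "w \<bullet> (R *v w + sqrt (d i) *\<^sub>R w) = 0" by simp
    then have "w \<bullet> (R *v w) + sqrt (d i) * (w \<bullet> w) = 0"
      by (simp add: inner_add_right)
    moreover have "w \<bullet> (R *v w) \<ge> 0" using R by (simp add: psd_def)
    ultimately have "sqrt (d i) * (w \<bullet> w) \<le> 0" by linarith
    then have "w \<bullet> w \<le> 0"
      using pos by (simp add: mult_le_0_iff)
    then have "w = 0" using inner_gt_zero_iff[of w] by linarith
    then show ?thesis by (simp add: w_def)
  qed
  have "R ** transpose Q = transpose Q ** diag_mat (\<lambda>i. sqrt (d i))"
  proof -
    have "(R ** transpose Q) $ a $ i = (transpose Q ** diag_mat (\<lambda>i. sqrt (d i))) $ a $ i" for a i
    proof -
      have "(R ** transpose Q) $ a $ i = (R *v f i) $ a"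
        by (simp add: matrix_matrix_mult_def matrix_vector_mult_def transpose_def f_nth)
      also have "\<dots> = (transpose Q ** diag_mat (\<lambda>i. sqrt (d i))) $ a $ i"
        unfolding Rf by (simp add: matrix_matrix_mult_def transpose_def f_nth diag_mat_def 
            if_distrib[where f="\<lambda>t. _ * t"] cong: if_cong)
      finally show ?thesis .
    qed
    then show ?thesis by (simp add: vec_eq_iff)
  qed
  then have "R ** (transpose Q ** Q) = conj_diag (\<lambda>i. sqrt (d i))"
    by (simp add: matrix_mul_assoc conj_diag_def)
  then show ?thesis by (simp add: QQ)
qed

lemma psd_sqrt_conj_diag:
  assumes "\<And>i. d i \<ge> 0"
  shows "psd_sqrt (conj_diag d) = conj_diag (\<lambda>i. sqrt (d i))"
  unfolding psd_sqrt_def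
proof (rule the_equality)
  show "psd (conj_diag (\<lambda>i. sqrt (d i))) \<and> conj_diag (\<lambda>i. sqrt (d i)) ** conj_diag (\<lambda>i. sqrt (d i)) = conj_diag d"
    using assms by (simp add: conj_diag_nonneg_imp_psd conj_diag_mult)
qed (use psd_root_unique assms in blast)

text \<open>Each of \<open>conj_diag d\<close> and \<open>diag_mat d\<close> is a product with the
  other as a factor, so their ranks agree; the range of the diagonal matrix is a coordinate
  subspace.\<close>

lemma rank_conj_diag: "rank (conj_diag d) = card {i. d i \<noteq> 0}"
proof -
  have "diag_mat d = Q ** conj_diag d ** transpose Q"
    using QQ by (simp add: conj_diag_def matrix_mul_assoc) (simp add: matrix_mul_assoc[symmetric])
  then have "rank (diag_mat d) \<le> rank (conj_diag d)"
    by (metis rank_mul_le_left rank_mul_le_right order_trans)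
  moreover have "rank (conj_diag d) \<le> rank (diag_mat d)"
    unfolding conj_diag_def by (metis rank_mul_le_left rank_mul_le_right order_trans)
  moreover have "range (\<lambda>x. diag_mat d *v x) = {x. \<forall>i. i \<notin> {i. d i \<noteq> 0} \<longrightarrow> x $ i = 0}"
  proof (safe)
    fix x :: "real^'n" assume "\<forall>i. i \<notin> {i. d i \<noteq> 0} \<longrightarrow> x $ i = 0"
    \<comment> \<open>Where \<open>d i = 0\<close> the quotient is 0 by convention, and
      \<open>x $ i = 0\<close> there as well.\<close>
    then have "x = diag_mat d *v (\<chi> i. x $ i / d i)"
      by (auto simp: vec_eq_iff diag_mat_mult_vec)
    then show "x \<in> range (\<lambda>x. diag_mat d *v x)" by blast
  qed (auto simp: diag_mat_mult_vec)
  then have "rank (diag_mat d) = card {i. d i \<noteq> 0}"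
    by (simp only: rank_dim_range dim_vec_eq[symmetric] dim_substandard_cart)
  ultimately show ?thesis by linarith
qed

end

lemma psd_conj_diag_cases:
  fixes S :: "real^'n^'n"
  assumes "psd S"
  obtains Q d where "orthogonal_matrix Q" "\<forall>i. d i \<ge> 0" "S = orthogonal_conjugation.conj_diag Q d"
proof -
  obtain Q d where Q: "orthogonal_matrix Q" and S: "S = transpose Q ** diag_mat d ** Q"
    using spectral_theorem_real_symmetric[of S] assms by (auto simp: psd_def)
  interpret orthogonal_conjugation Q by standard (rule Q)
  show thesis
    by (rule that[OF Q]) (use assms in \<open>auto simp: S conj_diag_def[symmetric] intro: psd_conj_diag_imp_nonneg\<close>)
qed

lemma psd_sqrt_square_symmetric:
  assumes "psd S"
  shows "psd_sqrt S ** psd_sqrt S = S" "transpose (psd_sqrt S) = psd_sqrt S"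
proof -
  obtain Q d where Q: "orthogonal_matrix Q" and d: "\<forall>i. d i \<ge> 0" and S: "S = orthogonal_conjugation.conj_diag Q d"
    using psd_conj_diag_cases[OF assms] by blast
  interpret orthogonal_conjugation Q by standard (rule Q)
  show "psd_sqrt S ** psd_sqrt S = S" "transpose (psd_sqrt S) = psd_sqrt S"
    using d by (simp_all add: S psd_sqrt_conj_diag conj_diag_nonneg_imp_psd conj_diag_mult)
qed

lemma psd_sqrt_mat_1: "psd_sqrt (mat 1 :: real^'n^'n) = mat 1"
proof -
  interpret orthogonal_conjugation "mat 1 :: real^'n^'n" by standard (rule orthogonal_matrix_id)
  show ?thesis
    using psd_sqrt_conj_diag[of "\<lambda>_. 1"] by (simp add: conj_diag_def diag_mat_one)
qed

section \<open>The Moore-Penrose pseudoinverse\<close>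

lemma pinv_eqI:
  fixes M :: "real^'n^'m" and X :: "real^'m^'n"
  assumes X: "M ** X ** M = M" "X ** M ** X = X" "transpose (M ** X) = M ** X" "transpose (X ** M) = X ** M"
  shows "pinv M = X"
  unfolding pinv_def
proof (rule the_equality)
  fix Z :: "real^'m^'n"
  assume "M ** Z ** M = M \<and> Z ** M ** Z = Z \<and> transpose (M ** Z) = M ** Z \<and> transpose (Z ** M) = Z ** M"
  then have Z: "M ** Z ** M = M" "Z ** M ** Z = Z" "transpose (M ** Z) = M ** Z" "transpose (Z ** M) = Z ** M"
    by auto
  \<comment> \<open>Both factors are symmetric, so transposing swaps them, and in the new order the
    product collapses to \<open>M ** X\<close>. The mirrored argument gives
    \<open>Z ** M = X ** M\<close>, and together they force \<open>Z = X\<close>.\<close>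
  have "M ** Z = (M ** X) ** (M ** Z)"
    using X(1) by (simp add: matrix_mul_assoc)
  also have "\<dots> = transpose ((M ** Z) ** (M ** X))"
    by (simp add: matrix_transpose_mul X(3)[unfolded matrix_transpose_mul] Z(3)[unfolded matrix_transpose_mul])
  also have "(M ** Z) ** (M ** X) = M ** X"
    using Z(1) by (simp add: matrix_mul_assoc)
  finally have MZ: "M ** Z = M ** X" using X(3) by simp
  have "Z ** M = (Z ** M) ** (X ** M)"
    using X(1) by (simp add: matrix_mul_assoc[symmetric])
  also have "\<dots> = transpose ((X ** M) ** (Z ** M))"
    by (simp add: matrix_transpose_mul X(4)[unfolded matrix_transpose_mul] Z(4)[unfolded matrix_transpose_mul])
  also have "(X ** M) ** (Z ** M) = X ** M"
    using Z(1) by (simp add: matrix_mul_assoc[symmetric])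
  finally have ZM: "Z ** M = X ** M" using X(4) by simp
  have "Z = Z ** M ** Z" using Z by simp
  also have "\<dots> = X ** M ** X" by (simp add: ZM MZ matrix_mul_assoc[symmetric])
  finally show "Z = X" using X by simp
qed (use assms in simp)

text \<open>The convention \<open>inverse 0 = 0\<close> matches the pseudoinverse on the kernel, so
  the Penrose equations hold eigenvalue by eigenvalue.\<close>

lemma (in orthogonal_conjugation) pinv_conj_diag: "pinv (conj_diag d) = conj_diag (\<lambda>i. inverse (d i))"
proof -
  have "(\<lambda>i. d i * inverse (d i) * d i) = d" "(\<lambda>i. inverse (d i) * d i * inverse (d i)) = (\<lambda>i. inverse (d i))"
    by (simp_all add: fun_eq_iff) (metis mult_zero_right mult_zero_left right_inverse left_inverse)+
  then show ?thesis
    by (intro pinv_eqI) (simp_all add: conj_diag_mult)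
qed

lemma pinv_inverse:
  fixes M X :: "real^'n^'n"
  assumes "M ** X = mat 1" "X ** M = mat 1"
  shows "pinv M = X"
  using assms by (intro pinv_eqI) simp_all

lemma psd_matrix_mult_transpose: "psd (L ** transpose L)"
  for L :: "real^'k^'n"
proof -
  have "x \<bullet> ((L ** transpose L) *v x) = (transpose L *v x) \<bullet> (transpose L *v x)" for x
    unfolding matrix_vector_mul_assoc[symmetric] by (rule inner_matrix_vector_transpose)
  then show ?thesis by (simp add: psd_def matrix_transpose_mul)
qed

section \<open>Linear images of the standard Gaussian\<close>

lemma matrix_mult_zero [simp]: "A ** 0 = 0" "0 ** A = 0"
  for A :: "real^'n^'m"
  by (simp_all add: matrix_matrix_mult_def vec_eq_iff)

lemma matrix_mult_add_right: "(A + B) ** C = A ** C + B ** C"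
  for A B :: "real^'n^'m"
  by (simp add: matrix_matrix_mult_def vec_eq_iff algebra_simps sum.distrib)

lemma transpose_add: "transpose (A + B) = transpose A + transpose B"
  by (simp add: transpose_def vec_eq_iff)

text \<open>The diagonal entries of the product are the squared norms of the rows.\<close>

lemma matrix_mult_transpose_eq_0:
  fixes A :: "real^'k^'n"
  assumes "A ** transpose A = 0"
  shows "A = 0"
proof -
  have "(\<Sum>k\<in>UNIV. (A $ i $ k)\<^sup>2) = (A ** transpose A) $ i $ i" for i
    by (simp add: matrix_matrix_mult_def transpose_def power2_eq_square)
  then have "(\<Sum>k\<in>UNIV. (A $ i $ k)\<^sup>2) = 0" for i
    by (simp add: assms)
  then show ?thesis
    by (simp add: vec_eq_iff sum_nonneg_eq_0_iff)
qed

text \<open>Columns are indexed like the entries of \<open>vec_join\<close>, so that a sum of linear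
  images of independent Gaussian vectors becomes one linear image of a single vector.\<close>

definition hcat :: "real^'p^'n \<Rightarrow> real^'q^'n \<Rightarrow> real^('p + 'q)^'n" where
  "hcat A B = (\<chi> i j. case j of Inl p \<Rightarrow> A $ i $ p | Inr q \<Rightarrow> B $ i $ q)"

lemma sum_UNIV_sum: "(\<Sum>j\<in>UNIV. g j) = (\<Sum>p\<in>UNIV. g (Inl p)) + (\<Sum>q\<in>UNIV. g (Inr q))"
  for g :: "'p::finite + 'q::finite \<Rightarrow> real"
  unfolding UNIV_sum by (subst sum.union_disjoint) (auto simp: sum.reindex)

lemma hcat_mult_vec: "hcat A B *v z = A *v (\<chi> p. z $ Inl p) + B *v (\<chi> q. z $ Inr q)"
  by (simp add: hcat_def matrix_vector_mult_def vec_eq_iff sum_UNIV_sum)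

lemma hcat_mult_vec_join: "hcat A B *v vec_join a b = A *v a + B *v b"
  by (simp add: hcat_mult_vec vec_join_def)

lemma hcat_mult_transpose: "hcat A B ** transpose (hcat A B) = A ** transpose A + B ** transpose B"
  by (simp add: hcat_def matrix_matrix_mult_def transpose_def vec_eq_iff sum_UNIV_sum)

text \<open>The hypothesis says that the rows are orthonormal. Once they are completed to an
  orthogonal matrix \<open>Q\<close>, the vector \<open>M *v z\<close> is a selection of coordinates
  of \<open>Q *v z\<close>.\<close>

lemma distr_std_gaussian_coisometry:
  fixes M :: "real^'k^'n"
  assumes M: "M ** transpose M = mat 1"
  shows "distr std_gaussian borel (\<lambda>z. M *v z) = std_gaussian"
proof -
  have inner: "row i M \<bullet> row j M = (if i = j then 1 else 0)" for i j
  proof -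
    have "row i M \<bullet> row j M = (M ** transpose M) $ i $ j"
      by (simp add: inner_vec_def row_def matrix_matrix_mult_def transpose_def)
    then show ?thesis by (simp add: M mat_def)
  qed
  have inj_row: "inj (\<lambda>i. row i M)"
  proof (rule injI)
    fix i j assume "row i M = row j M"
    then have "row i M \<bullet> row j M = row i M \<bullet> row i M" by simp
    then show "i = j" by (simp add: inner split: if_splits)
  qed
  obtain B where B: "range (\<lambda>i. row i M) \<subseteq> B" "pairwise orthogonal B" "\<And>x. x \<in> B \<Longrightarrow> norm x = 1" "card B = CARD('k)"
  proof (rule extend_orthonormal[of "range (\<lambda>i. row i M)"])
    show "pairwise orthogonal (range (\<lambda>i. row i M))"
      by (auto simp: pairwise_def orthogonal_def inner split: if_splits)
    show "norm x = 1" if "x \<in> range (\<lambda>i. row i M)" for x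
      using that by (auto simp: norm_eq_1 inner)
  qed blast
  have "finite B" using B(4) by (metis card.infinite zero_less_card_finite less_irrefl)
  then obtain f :: "'k \<Rightarrow> real^'k" where f: "bij_betw f UNIV B"
    using finite_same_card_bij[of "UNIV::'k set" B] B(4) by auto
  have fB: "f i \<in> B" for i using f by (auto simp: bij_betw_def)
  \<comment> \<open>\<open>h i\<close> is the position of row \<open>i\<close> of \<open>M\<close>
    in the orthonormal basis \<open>f\<close>; it is injective because the rows are
    distinct.\<close>
  define h where "h i = inv f (row i M)" for i
  have fh: "f (h i) = row i M" for i
  proof -
    have "row i M \<in> range f" using B(1) f by (auto simp: bij_betw_def)
    then show ?thesis by (simp add: h_def f_inv_into_f)
  qed
  have "inj h" using fh inj_row by (metis injD injI)
  define Q where "Q = (\<chi> i j. f i $ j)"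
  have Q: "orthogonal_matrix Q"
    unfolding Q_def
  proof (rule orthogonal_matrix_of_orthonormal_basis)
    show "norm (f i) = 1" for i using B fB by auto
    show "orthogonal (f i) (f j)" if "i \<noteq> j" for i j
    proof -
      have "f i \<noteq> f j" using f that by (auto simp: bij_betw_def inj_def)
      then show ?thesis using B fB by (auto simp: pairwise_def)
    qed
  qed
  have Mz: "M *v z = (\<chi> i. (Q *v z) $ h i)" for z
    by (simp add: vec_eq_iff Q_def fh row_def matrix_vector_mult_def)
  have "distr std_gaussian borel (\<lambda>z. M *v z) = distr (distr std_gaussian borel (\<lambda>z. Q *v z)) borel (\<lambda>z. \<chi> i. z $ h i)"
    unfolding Mz by (subst distr_distr) (auto simp: o_def)
  then show ?thesis
    by (simp add: distr_std_gaussian_orthogonal_matrix[OF Q] distr_std_gaussian_select[OF \<open>inj h\<close>])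
qed

text \<open>Let \<open>S = L L\<^sup>T\<close>, let \<open>P\<close> be the square root of its pseudoinverse and \<open>N\<close> the projection
  onto its kernel. Then \<open>w = P L z + N z'\<close>, with independent noise \<open>z'\<close>, is standard Gaussian in
  the target dimension, and the square root of \<open>S\<close> maps \<open>w\<close> to \<open>L z\<close>.\<close>

lemma distr_std_gaussian_psd_sqrt:
  fixes L :: "real^'k^'n"
  shows "distr std_gaussian borel (\<lambda>z. psd_sqrt (L ** transpose L) *v z) = distr std_gaussian borel (\<lambda>z. L *v z)"
proof -
  define S where "S = L ** transpose L"
  obtain Q d where Q: "orthogonal_matrix Q" and d: "\<forall>i. d i \<ge> 0" and S: "S = orthogonal_conjugation.conj_diag Q d"
    using psd_conj_diag_cases[OF psd_matrix_mult_transpose[of L]] unfolding S_def by blast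
  interpret orthogonal_conjugation Q by standard (rule Q)
  define R where "R = conj_diag (\<lambda>i. sqrt (d i))"
  define P where "P = conj_diag (\<lambda>i. inverse (sqrt (d i)))"
  define N where "N = conj_diag (\<lambda>i. if d i = 0 then 1 else 0)"
  have one: "conj_diag (\<lambda>_. 1) = mat 1"
    by (simp add: conj_diag_def diag_mat_one QQ)
  have add: "conj_diag e + conj_diag f = conj_diag (\<lambda>i. e i + f i)" for e f
  proof -
    have "diag_mat (\<lambda>i. e i + f i) = diag_mat e + diag_mat f"
      by (simp add: diag_mat_def vec_eq_iff)
    then show ?thesis
      by (simp add: conj_diag_def matrix_add_ldistrib matrix_mult_add_right)
  qed
  have zero: "conj_diag (\<lambda>_. 0) = 0"
    using add[of "\<lambda>_. 0" "\<lambda>_. 0"] by simp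
  have R: "psd_sqrt S = R" using d by (simp add: S R_def psd_sqrt_conj_diag)
  define M where "M = hcat (P ** L) N"
  have "M ** transpose M = P ** S ** P + N ** N"
    by (simp add: M_def hcat_mult_transpose matrix_transpose_mul matrix_mul_assoc S_def P_def N_def)
  also have "\<dots> = conj_diag (\<lambda>_. 1)"
  proof -
    \<comment> \<open>The first summand is 1 for \<open>d i > 0\<close>, the second for
      \<open>d i = 0\<close>, and the other one is 0 in each case.\<close>
    have "inverse (sqrt (d i)) * d i * inverse (sqrt (d i)) + (if d i = 0 then 1 else 0) * (if d i = 0 then 1 else 0) = 1" for i
      using d[rule_format, of i] by (auto simp: field_simps)
    then show ?thesis
      unfolding P_def S N_def conj_diag_mult add by simp
  qed
  finally have M: "M ** transpose M = mat 1" by (simp add: one)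
  have RN: "R ** N = 0"
  proof -
    have "(\<lambda>i. sqrt (d i) * (if d i = 0 then 1 else 0)) = (\<lambda>_. 0)" by auto
    then show ?thesis by (simp add: R_def N_def conj_diag_mult zero)
  qed
  have NL: "N ** L = 0"
  proof (rule matrix_mult_transpose_eq_0)
    have "(N ** L) ** transpose (N ** L) = N ** S ** N"
      by (simp add: matrix_transpose_mul matrix_mul_assoc S_def N_def)
    also have "\<dots> = 0"
    proof -
      have "(\<lambda>i. (if d i = 0 then 1 else 0) * d i * (if d i = 0 then 1 else 0)) = (\<lambda>_. 0)" by auto
      then show ?thesis by (simp add: S N_def conj_diag_mult zero)
    qed
    finally show "(N ** L) ** transpose (N ** L) = 0" .
  qed
  have RPL: "R ** (P ** L) = L"
  proof -
    \<comment> \<open>\<open>R ** P\<close> and \<open>N\<close> are complementary projections and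
      \<open>N\<close> annihilates \<open>L\<close>, so \<open>R ** P\<close> fixes
      \<open>L\<close>.\<close>
    have "R ** P + N = mat 1"
    proof -
      have "sqrt (d i) * inverse (sqrt (d i)) + (if d i = 0 then 1 else 0) = 1" for i by simp
      then show ?thesis by (simp only: R_def P_def N_def conj_diag_mult add one)
    qed
    then have "(R ** P + N) ** L = L" by simp
    then show ?thesis by (simp add: matrix_mult_add_right NL matrix_mul_assoc)
  qed
  have RM: "R *v (M *v z) = L *v (\<chi> i. z $ Inl i)" for z
  proof -
    have "R *v (M *v z) = (R ** (P ** L)) *v (\<chi> i. z $ Inl i) + (R ** N) *v (\<chi> i. z $ Inr i)"
      by (simp only: M_def hcat_mult_vec matrix_vector_right_distrib matrix_vector_mul_assoc)
    then show ?thesis by (simp add: RPL RN)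
  qed
  \<comment> \<open>The standard Gaussian on the left is realised as \<open>M *v z\<close> with
    \<open>z\<close> in the joined space. After \<open>R\<close> only the first block of
    \<open>z\<close> survives, and that block is again standard Gaussian.\<close>
  have "distr std_gaussian borel (\<lambda>z. R *v z) = distr (distr std_gaussian borel (\<lambda>z. M *v z)) borel (\<lambda>z. R *v z)"
    by (simp add: distr_std_gaussian_coisometry[OF M])
  also have "\<dots> = distr std_gaussian borel (\<lambda>z::real^('k + 'n). L *v (\<chi> i. z $ Inl i))"
    by (subst distr_distr) (auto simp: o_def RM)
  also have "\<dots> = distr (distr std_gaussian borel (\<lambda>z::real^('k + 'n). \<chi> i. z $ Inl i)) borel (\<lambda>z. L *v z)"
    by (subst distr_distr) (auto simp: o_def)
  also have "\<dots> = distr std_gaussian borel (\<lambda>z. L *v z)"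
    by (simp add: distr_std_gaussian_select)
  finally show ?thesis using R by (simp add: S_def)
qed

text \<open>Any factor of the covariance, even a rectangular one, may replace the symmetric root in
  \<open>gaussian\<close>. Both \<open>L\<close> and the block matrix \<open>hcat V L\<close> are
  used in this role.\<close>

lemma gaussian_mult_transpose:
  fixes L :: "real^'k^'n"
  shows "gaussian \<mu> (L ** transpose L) = distr std_gaussian borel (\<lambda>z. \<mu> + L *v z)"
proof -
  have "gaussian \<mu> (L ** transpose L) = distr (distr std_gaussian borel (\<lambda>z. psd_sqrt (L ** transpose L) *v z)) borel ((+) \<mu>)"
    unfolding gaussian_def by (subst distr_distr) (auto simp: o_def)
  also have "\<dots> = distr std_gaussian borel (\<lambda>z. \<mu> + L *v z)"
    unfolding distr_std_gaussian_psd_sqrt by (subst distr_distr) (auto simp: o_def)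
  finally show ?thesis .
qed

lemma gaussian_0_1: "gaussian 0 (mat 1) = std_gaussian"
  by (simp add: gaussian_def psd_sqrt_mat_1 distr_id2)

text \<open>With the symmetric root \<open>R\<close> of \<open>S\<close> in place of
  \<open>L\<close>, the quadratic form is that of \<open>R ** pinv S ** R\<close>, the orthogonal
  projection onto the range of \<open>S\<close>. In the eigenbasis it sums the squares belonging to
  nonzero eigenvalues, whose number is the rank.\<close>

lemma gaussian_pinv_chi_squared:
  fixes L :: "real^'k^'n"
  shows "distr std_gaussian borel (\<lambda>z. (L *v z) \<bullet> (pinv (L ** transpose L) *v (L *v z))) = chi_squared (rank (L ** transpose L))"
proof -
  define S where "S = L ** transpose L"
  obtain Q d where Q: "orthogonal_matrix Q" and d: "\<forall>i. d i \<ge> 0" and S: "S = orthogonal_conjugation.conj_diag Q d"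
    using psd_conj_diag_cases[OF psd_matrix_mult_transpose[of L]] unfolding S_def by blast
  interpret orthogonal_conjugation Q by standard (rule Q)
  let ?J = "{i. d i \<noteq> 0}"
  have quad: "(psd_sqrt S *v z) \<bullet> (pinv S *v (psd_sqrt S *v z)) = (\<Sum>i\<in>?J. ((Q *v z) $ i)\<^sup>2)" for z
  proof -
    define R where "R = psd_sqrt S"
    have R: "R = conj_diag (\<lambda>i. sqrt (d i))" using d by (simp add: R_def S psd_sqrt_conj_diag)
    have "(R *v z) \<bullet> (pinv S *v (R *v z)) = z \<bullet> (R *v (pinv S *v (R *v z)))"
      by (rule inner_symmetric_matrix[symmetric]) (simp add: R)
    also have "\<dots> = z \<bullet> (conj_diag (\<lambda>i. sqrt (d i) * (inverse (d i) * sqrt (d i))) *v z)"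
      by (simp only: matrix_vector_mul_assoc R S pinv_conj_diag conj_diag_mult)
    also have "(\<lambda>i. sqrt (d i) * (inverse (d i) * sqrt (d i))) = (\<lambda>i. if i \<in> ?J then 1 else 0)"
      using d by (auto simp: fun_eq_iff field_simps)
    also have "z \<bullet> (conj_diag \<dots> *v z) = (\<Sum>i\<in>?J. ((Q *v z) $ i)\<^sup>2)"
      unfolding inner_conj_diag by (intro sum.mono_neutral_cong_right) auto
    finally show ?thesis by (simp add: R_def)
  qed
  have "distr std_gaussian borel (\<lambda>z. (L *v z) \<bullet> (pinv S *v (L *v z)))
      = distr (distr std_gaussian borel (\<lambda>z. L *v z)) borel (\<lambda>y. y \<bullet> (pinv S *v y))"
    by (subst distr_distr) (auto simp: o_def)
  also have "\<dots> = distr (distr std_gaussian borel (\<lambda>z. psd_sqrt S *v z)) borel (\<lambda>y. y \<bullet> (pinv S *v y))"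
    by (simp add: distr_std_gaussian_psd_sqrt S_def)
  also have "\<dots> = distr std_gaussian borel (\<lambda>z. \<Sum>i\<in>?J. ((Q *v z) $ i)\<^sup>2)"
    by (subst distr_distr) (auto simp: o_def quad)
  also have "\<dots> = distr (distr std_gaussian borel (\<lambda>z. Q *v z)) borel (\<lambda>z. \<Sum>i\<in>?J. (z $ i)\<^sup>2)"
    by (subst distr_distr) (auto simp: o_def)
  also have "\<dots> = chi_squared (card ?J)"
    by (simp add: distr_std_gaussian_orthogonal_matrix[OF Q] distr_std_gaussian_sum_squares)
  finally show ?thesis
    using rank_conj_diag[of d] by (simp add: S S_def[symmetric])
qed

section \<open>Conditional distributions\<close>

lemma indep_rvs_joint_distr:
  fixes X :: "'a \<Rightarrow> 'x::second_countable_topology" and Y :: "'a \<Rightarrow> 'y::second_countable_topology"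
  assumes "prob_space M" and "indep_rvs M X Y"
  shows "distr M borel X \<Otimes>\<^sub>M distr M borel Y = distr M (borel \<Otimes>\<^sub>M borel) (\<lambda>\<omega>. (X \<omega>, Y \<omega>))"
proof -
  interpret prob_space M by fact
  have [measurable]: "X \<in> borel_measurable M" "Y \<in> borel_measurable M"
    and indep: "indep_set {X -` B \<inter> space M |B. B \<in> sets borel} {Y -` C \<inter> space M |C. C \<in> sets borel}"
    using assms(2) by (auto simp: indep_rvs_def)
  interpret X: prob_space "distr M borel X" by (rule prob_space_distr) measurable
  interpret Y: prob_space "distr M borel Y" by (rule prob_space_distr) measurable
  show ?thesis
  proof (rule pair_measure_eqI)
    fix B C assume "B \<in> sets (distr M borel X)" "C \<in> sets (distr M borel Y)"
    then have [measurable]: "B \<in> sets borel" "C \<in> sets borel" by simp_all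
    have "emeasure (distr M (borel \<Otimes>\<^sub>M borel) (\<lambda>\<omega>. (X \<omega>, Y \<omega>))) (B \<times> C)
        = emeasure M ((X -` B \<inter> space M) \<inter> (Y -` C \<inter> space M))"
      by (subst emeasure_distr) (auto intro!: arg_cong[where f="emeasure M"])
    also have "\<dots> = ennreal (prob (X -` B \<inter> space M) * prob (Y -` C \<inter> space M))"
      unfolding emeasure_eq_measure by (subst indep_setD[OF indep]) auto
    also have "\<dots> = emeasure (distr M borel X) B * emeasure (distr M borel Y) C"
      by (simp add: emeasure_distr emeasure_eq_measure ennreal_mult)
    finally show "emeasure (distr M borel X) B * emeasure (distr M borel Y) C
      = emeasure (distr M (borel \<Otimes>\<^sub>M borel) (\<lambda>\<omega>. (X \<omega>, Y \<omega>))) (B \<times> C)" by simp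
  qed (auto intro: X.sigma_finite_measure_axioms Y.sigma_finite_measure_axioms cong: sets_pair_measure_cong)
qed

text \<open>If the observation is \<open>h a\<close>, and \<open>X\<close> depends on
  \<open>a\<close> only through it and otherwise on an independent \<open>z\<close>, then
  conditioning freezes \<open>h a\<close> at \<open>y\<close> and leaves \<open>z\<close> random.
  Both conditional laws in the theorem arise this way.\<close>

lemma is_cond_distrI:
  fixes X :: "'a \<Rightarrow> 'x::topological_space" and Y :: "'a \<Rightarrow> 'y::topological_space"
  assumes XY[measurable]: "X \<in> borel_measurable M" "Y \<in> borel_measurable M"
    and \<mu>: "prob_space \<mu>" and \<nu>: "prob_space \<nu>"
    and h[measurable]: "h \<in> borel_measurable \<mu>"
    and g[measurable]: "(\<lambda>(y, z). g y z) \<in> borel_measurable (borel \<Otimes>\<^sub>M \<nu>)"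
    and joint: "distr M (borel \<Otimes>\<^sub>M borel) (\<lambda>\<omega>. (X \<omega>, Y \<omega>))
      = distr (\<mu> \<Otimes>\<^sub>M \<nu>) (borel \<Otimes>\<^sub>M borel) (\<lambda>(a, z). (g (h a) z, h a))"
  shows "is_cond_distr M X Y (\<lambda>y. distr \<nu> borel (g y))"
proof -
  interpret \<nu>: prob_space \<nu> by fact
  let ?\<kappa> = "\<lambda>y. distr \<nu> borel (g y)"
  have "(\<lambda>_. \<nu>) \<in> borel \<rightarrow>\<^sub>M prob_algebra \<nu>"
    by (rule measurable_const) (simp add: space_prob_algebra \<nu>)
  then have \<kappa>[measurable]: "?\<kappa> \<in> borel \<rightarrow>\<^sub>M prob_algebra borel"
    by (rule measurable_distr_prob_space2) (rule g)
  have g'[measurable]: "g y \<in> borel_measurable \<nu>" for y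
    using measurable_Pair2[OF g, of y] by simp
  have gh[measurable]: "(\<lambda>(a, z). g (h a) z) \<in> borel_measurable (\<mu> \<Otimes>\<^sub>M \<nu>)"
  proof -
    have "(\<lambda>p. (case (h (fst p), snd p) of (y, z) \<Rightarrow> g y z)) \<in> borel_measurable (\<mu> \<Otimes>\<^sub>M \<nu>)"
      by (rule measurable_compose[OF _ g]) measurable
    then show ?thesis by (simp add: case_prod_beta')
  qed
  have "emeasure M {\<omega> \<in> space M. X \<omega> \<in> B \<and> Y \<omega> \<in> C} = (\<integral>\<^sup>+y\<in>C. emeasure (?\<kappa> y) B \<partial>distr M borel Y)"
    if [measurable]: "B \<in> sets borel" "C \<in> sets borel" for B C
  proof -
    have \<kappa>B[measurable]: "(\<lambda>y. emeasure (?\<kappa> y) B) \<in> borel_measurable borel"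
      using measurable_compose[OF measurable_prob_algebraD[OF \<kappa>] measurable_emeasure_subprob_algebra[OF that(1)]] .
    have inner: "(\<integral>\<^sup>+z. indicator B (g (h a) z) \<partial>\<nu>) = emeasure (?\<kappa> (h a)) B" for a
    proof -
      have "(\<integral>\<^sup>+z. indicator B (g (h a) z) \<partial>\<nu>) = (\<integral>\<^sup>+x. indicator B x \<partial>?\<kappa> (h a))"
        by (subst nn_integral_distr) auto
      then show ?thesis by simp
    qed
    have gh'[measurable]: "(\<lambda>p. g (h (fst p)) (snd p)) \<in> borel_measurable (\<mu> \<Otimes>\<^sub>M \<nu>)"
      using gh by (simp add: case_prod_beta')
    have "emeasure M {\<omega> \<in> space M. X \<omega> \<in> B \<and> Y \<omega> \<in> C} = (\<integral>\<^sup>+\<omega>. indicator (B \<times> C) (X \<omega>, Y \<omega>) \<partial>M)"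
    proof -
      have "emeasure M {\<omega> \<in> space M. X \<omega> \<in> B \<and> Y \<omega> \<in> C}
          = (\<integral>\<^sup>+\<omega>. indicator {\<omega> \<in> space M. X \<omega> \<in> B \<and> Y \<omega> \<in> C} \<omega> \<partial>M)"
        by (rule nn_integral_indicator[symmetric]) measurable
      also have "\<dots> = (\<integral>\<^sup>+\<omega>. indicator (B \<times> C) (X \<omega>, Y \<omega>) \<partial>M)"
        by (rule nn_integral_cong) (simp add: indicator_def)
      finally show ?thesis .
    qed
    also have "\<dots> = (\<integral>\<^sup>+p. indicator (B \<times> C) p \<partial>distr M (borel \<Otimes>\<^sub>M borel) (\<lambda>\<omega>. (X \<omega>, Y \<omega>)))"
      by (subst nn_integral_distr) auto
    also have "\<dots> = (\<integral>\<^sup>+p. indicator B (g (h (fst p)) (snd p)) * indicator C (h (fst p)) \<partial>(\<mu> \<Otimes>\<^sub>M \<nu>))"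
      unfolding joint
      by (subst nn_integral_distr) (auto simp: case_prod_beta' indicator_times)
    also have "\<dots> = (\<integral>\<^sup>+a. \<integral>\<^sup>+z. indicator B (g (h a) z) * indicator C (h a) \<partial>\<nu> \<partial>\<mu>)"
      by (subst \<nu>.nn_integral_fst[symmetric]) auto
    also have "\<dots> = (\<integral>\<^sup>+a. emeasure (?\<kappa> (h a)) B * indicator C (h a) \<partial>\<mu>)"
      by (intro nn_integral_cong) (simp add: nn_integral_multc inner)
    \<comment> \<open>The integrand is constant in \<open>z\<close> and \<open>\<nu>\<close> has
      mass 1. Reinserting the integral over \<open>z\<close> leads back to the joint law, and from
      there to \<open>M\<close>.\<close>
    also have "\<dots> = (\<integral>\<^sup>+a. \<integral>\<^sup>+z. emeasure (?\<kappa> (h a)) B * indicator C (h a) \<partial>\<nu> \<partial>\<mu>)"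
      by (simp add: \<nu>.emeasure_space_1)
    also have "\<dots> = (\<integral>\<^sup>+p. emeasure (?\<kappa> (h (fst p))) B * indicator C (h (fst p)) \<partial>(\<mu> \<Otimes>\<^sub>M \<nu>))"
      by (subst \<nu>.nn_integral_fst[symmetric]) auto
    also have "\<dots> = (\<integral>\<^sup>+p. emeasure (?\<kappa> (snd p)) B * indicator C (snd p) \<partial>distr M (borel \<Otimes>\<^sub>M borel) (\<lambda>\<omega>. (X \<omega>, Y \<omega>)))"
      unfolding joint by (subst nn_integral_distr) (auto simp: case_prod_beta')
    also have "\<dots> = (\<integral>\<^sup>+\<omega>. emeasure (?\<kappa> (Y \<omega>)) B * indicator C (Y \<omega>) \<partial>M)"
      by (subst nn_integral_distr) auto
    also have "\<dots> = (\<integral>\<^sup>+y\<in>C. emeasure (?\<kappa> y) B \<partial>distr M borel Y)"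
      by (subst nn_integral_distr) auto
    finally show ?thesis .
  qed
  then show ?thesis
    using \<kappa> by (simp add: is_cond_distr_def)
qed

section \<open>Conditioning a Gaussian vector on a linear observation\<close>

lemma matrix_inv_mult:
  fixes C :: "real^'n^'n"
  assumes "det C \<noteq> 0"
  shows "C ** matrix_inv C = mat 1" "matrix_inv C ** C = mat 1"
proof -
  have "invertible C" using assms by (simp add: invertible_det_nz)
  then have "C ** matrix_inv C = mat 1 \<and> matrix_inv C ** C = mat 1"
    unfolding invertible_def matrix_inv_def by (rule someI_ex)
  then show "C ** matrix_inv C = mat 1" "matrix_inv C ** C = mat 1" by auto
qed

text \<open>Since \<open>B ** L = 0\<close>, the observation has covariance
  \<open>C ** transpose C\<close> with \<open>C = B ** V\<close> invertible. The pseudoinverse is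
  then an inverse, the gain reduces to \<open>V ** matrix_inv C\<close>, and conditioning removes
  exactly \<open>V ** transpose V\<close> from the covariance.\<close>

lemma gaussian_cond_eq:
  fixes V :: "real^'m^'n" and L :: "real^'k^'n" and B :: "real^'n^'m"
  assumes BL: "B ** L = 0" and det: "det (B ** V) \<noteq> 0"
  shows "gaussian_cond \<mu> (V ** transpose V + L ** transpose L) B y
    = distr std_gaussian borel (\<lambda>z. \<mu> + (V ** matrix_inv (B ** V)) *v (y - B *v \<mu>) + L *v z)"
proof -
  define C where "C = B ** V"
  define D where "D = matrix_inv C"
  define \<Sigma> where "\<Sigma> = V ** transpose V + L ** transpose L"
  have CD: "C ** D = mat 1" "D ** C = mat 1"
    using matrix_inv_mult[OF det] by (simp_all add: C_def D_def)
  have tCD: "transpose C ** transpose D = mat 1" "transpose D ** transpose C = mat 1"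
    using CD by (metis matrix_transpose_mul transpose_mat)+
  have B\<Sigma>: "B ** \<Sigma> = C ** transpose V"
    by (simp add: \<Sigma>_def matrix_add_ldistrib matrix_mul_assoc BL C_def)
  have \<Sigma>B: "\<Sigma> ** transpose B = V ** transpose C"
  proof -
    have "transpose \<Sigma> = \<Sigma>" by (simp add: \<Sigma>_def transpose_add matrix_transpose_mul)
    then show ?thesis using B\<Sigma> by (metis matrix_transpose_mul transpose_transpose)
  qed
  have "pinv (B ** \<Sigma> ** transpose B) = transpose D ** D"
  proof (rule pinv_inverse)
    have BB: "B ** \<Sigma> ** transpose B = C ** transpose C"
      by (simp add: B\<Sigma> matrix_mul_assoc[symmetric] C_def matrix_transpose_mul)
    have "(C ** transpose C) ** (transpose D ** D) = C ** (transpose C ** transpose D) ** D"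
      by (simp add: matrix_mul_assoc)
    then show "B ** \<Sigma> ** transpose B ** (transpose D ** D) = mat 1" by (simp add: BB tCD CD)
    have "(transpose D ** D) ** (C ** transpose C) = transpose D ** (D ** C) ** transpose C"
      by (simp add: matrix_mul_assoc)
    then show "transpose D ** D ** (B ** \<Sigma> ** transpose B) = mat 1" by (simp add: BB tCD CD)
  qed
  then have K: "\<Sigma> ** transpose B ** pinv (B ** \<Sigma> ** transpose B) = V ** D"
  proof -
    have "V ** transpose C ** (transpose D ** D) = V ** (transpose C ** transpose D) ** D"
      by (simp add: matrix_mul_assoc)
    then show ?thesis
      using \<open>pinv (B ** \<Sigma> ** transpose B) = transpose D ** D\<close> by (simp add: \<Sigma>B tCD)
  qed
  have "\<Sigma> - V ** D ** B ** \<Sigma> = L ** transpose L"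
  proof -
    have "V ** D ** B ** \<Sigma> = V ** (D ** C) ** transpose V"
      by (simp add: B\<Sigma> matrix_mul_assoc[symmetric])
    then show ?thesis by (simp add: CD \<Sigma>_def)
  qed
  then show ?thesis
    unfolding gaussian_cond_def Let_def \<Sigma>_def[symmetric] K
    by (simp add: gaussian_mult_transpose C_def[symmetric] D_def[symmetric])
qed

lemma is_cond_distr_gaussian_cond:
  fixes V :: "real^'m^'n" and L :: "real^'k^'n" and B :: "real^'n^'m"
  assumes BL: "B ** L = 0" and det: "det (B ** V) \<noteq> 0"
    and x[measurable]: "x \<in> borel_measurable P"
    and law: "distr P borel x = gaussian \<mu> (V ** transpose V + L ** transpose L)"
  shows "is_cond_distr P x (\<lambda>\<omega>. B *v x \<omega>) (gaussian_cond \<mu> (V ** transpose V + L ** transpose L) B)"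
proof -
  define D where "D = matrix_inv (B ** V)"
  \<comment> \<open>\<open>h a\<close> is the observation when the first Gaussian block is
    \<open>a\<close>, and \<open>g\<close> recovers \<open>V *v a\<close> from it by means of the
    gain. This is the form that \<open>is_cond_distrI\<close> expects.\<close>
  define h where "h a = B *v \<mu> + (B ** V) *v a" for a
  define g where "g y z = \<mu> + (V ** D) *v (y - B *v \<mu>) + L *v z" for y z
  have gh: "g (h a) z = \<mu> + V *v a + L *v z" for a z
  proof -
    have "(V ** D) *v ((B ** V) *v a) = (V ** (D ** (B ** V))) *v a"
      by (simp only: matrix_vector_mul_assoc matrix_mul_assoc)
    then show ?thesis
      using matrix_inv_mult(2)[OF det] by (simp add: g_def h_def D_def)
  qed
  have Bgh: "B *v (g (h a) z) = h a" for a z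
  proof -
    have "B *v (L *v z) = 0" by (simp add: matrix_vector_mul_assoc BL)
    then show ?thesis
      unfolding gh by (simp add: h_def matrix_vector_right_distrib matrix_vector_mul_assoc)
  qed
  have [measurable]: "h \<in> borel_measurable borel"
    unfolding h_def by measurable
  have [measurable]: "(\<lambda>(y, z). g y z) \<in> borel_measurable (borel \<Otimes>\<^sub>M std_gaussian)"
    unfolding g_def case_prod_beta' by measurable
  \<comment> \<open>The covariance factors through \<open>hcat V L\<close>, and the standard
    Gaussian in the joined space splits into independent blocks \<open>a\<close> and
    \<open>z\<close>.\<close>
  have "distr P borel x = distr std_gaussian borel (\<lambda>z. \<mu> + hcat V L *v z)"
    unfolding law hcat_mult_transpose[symmetric] by (rule gaussian_mult_transpose)
  also have "\<dots> = distr (distr (std_gaussian \<Otimes>\<^sub>M std_gaussian) borel (\<lambda>(a, b). vec_join a b)) borel (\<lambda>z. \<mu> + hcat V L *v z)"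
    by (simp add: distr_std_gaussian_vec_join)
  also have "\<dots> = distr (std_gaussian \<Otimes>\<^sub>M std_gaussian) borel (\<lambda>(a, z). g (h a) z)"
    by (subst distr_distr) (auto simp: o_def case_prod_beta' hcat_mult_vec_join gh add.assoc)
  finally have law': "distr P borel x = distr (std_gaussian \<Otimes>\<^sub>M std_gaussian) borel (\<lambda>(a, z). g (h a) z)" .
  have "is_cond_distr P x (\<lambda>\<omega>. B *v x \<omega>) (\<lambda>y. distr std_gaussian borel (g y))"
  proof (rule is_cond_distrI[where \<mu>=std_gaussian and h=h])
    have "distr P (borel \<Otimes>\<^sub>M borel) (\<lambda>\<omega>. (x \<omega>, B *v x \<omega>)) = distr (distr P borel x) (borel \<Otimes>\<^sub>M borel) (\<lambda>x. (x, B *v x))"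
      by (subst distr_distr) (auto simp: o_def)
    also have "\<dots> = distr (std_gaussian \<Otimes>\<^sub>M std_gaussian) (borel \<Otimes>\<^sub>M borel) (\<lambda>(a, z). (g (h a) z, h a))"
      unfolding law' by (subst distr_distr) (auto simp: o_def case_prod_beta' Bgh[unfolded gh] gh)
    finally show "distr P (borel \<Otimes>\<^sub>M borel) (\<lambda>\<omega>. (x \<omega>, B *v x \<omega>))
      = distr (std_gaussian \<Otimes>\<^sub>M std_gaussian) (borel \<Otimes>\<^sub>M borel) (\<lambda>(a, z). (g (h a) z, h a))" .
  qed (auto simp: prob_space_std_gaussian)
  moreover have "gaussian_cond \<mu> (V ** transpose V + L ** transpose L) B = (\<lambda>y. distr std_gaussian borel (g y))"
    by (rule ext) (simp add: gaussian_cond_eq[OF BL det] g_def[abs_def] D_def)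
  ultimately show ?thesis by simp
qed

text \<open>The case of \<open>is_cond_distrI\<close> in which \<open>v\<close> itself is observed
  and \<open>h\<close> is the identity.\<close>

lemma is_cond_distr_indep:
  fixes v :: "'a \<Rightarrow> 'y::second_countable_topology" and \<eta> :: "'a \<Rightarrow> 'z::second_countable_topology"
    and g :: "'y \<Rightarrow> 'z \<Rightarrow> 'x::topological_space"
  assumes M: "prob_space M" and indep: "indep_rvs M v \<eta>"
    and g[measurable]: "(\<lambda>(y, z). g y z) \<in> borel_measurable (borel \<Otimes>\<^sub>M borel)"
  shows "is_cond_distr M (\<lambda>\<omega>. g (v \<omega>) (\<eta> \<omega>)) v (\<lambda>y. distr M borel (\<lambda>\<omega>. g y (\<eta> \<omega>)))"
proof -
  interpret prob_space M by fact
  have [measurable]: "v \<in> borel_measurable M" "\<eta> \<in> borel_measurable M"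
    using indep by (auto simp: indep_rvs_def)
  have g'[measurable]: "g y \<in> borel_measurable borel" for y
    using measurable_Pair2[OF g, of y] by simp
  have gv[measurable]: "(\<lambda>\<omega>. g (v \<omega>) (\<eta> \<omega>)) \<in> borel_measurable M"
  proof -
    have "(\<lambda>\<omega>. (case (v \<omega>, \<eta> \<omega>) of (y, z) \<Rightarrow> g y z)) \<in> borel_measurable M"
      by (rule measurable_compose[OF _ g]) measurable
    then show ?thesis by simp
  qed
  have "is_cond_distr M (\<lambda>\<omega>. g (v \<omega>) (\<eta> \<omega>)) v (\<lambda>y. distr (distr M borel \<eta>) borel (g y))"
  proof (rule is_cond_distrI[where \<mu>="distr M borel v" and h="\<lambda>y. y"])
    have gp[measurable]: "(\<lambda>p. g (fst p) (snd p)) \<in> borel_measurable (borel \<Otimes>\<^sub>M borel)"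
      using g by (simp add: case_prod_beta')
    show "distr M (borel \<Otimes>\<^sub>M borel) (\<lambda>\<omega>. (g (v \<omega>) (\<eta> \<omega>), v \<omega>)) =
      distr (distr M borel v \<Otimes>\<^sub>M distr M borel \<eta>) (borel \<Otimes>\<^sub>M borel) (\<lambda>(a, z). (g a z, a))"
      unfolding indep_rvs_joint_distr[OF M indep]
      by (subst distr_distr) (auto simp: o_def case_prod_beta')
  qed (auto intro!: prob_space_distr simp: g cong: measurable_cong_sets)
  moreover have "distr (distr M borel \<eta>) borel (g y) = distr M borel (\<lambda>\<omega>. g y (\<eta> \<omega>))" for y
    by (subst distr_distr) (auto simp: o_def)
  ultimately show ?thesis by simp
qed

text \<open>Conditional laws are determined only almost surely, so item 1 names explicit versions,
  shows that they are conditional distributions, and equates them at every \<open>v0\<close>. In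
  item 2 the degrees of freedom are the rank of \<open>Y ** G ** transpose Y\<close>; a singular
  \<open>G\<close> can push it below the dimension of the kernel of \<open>transpose W ** A\<close>,
  whence the rank condition.\<close>

theorem theorem3:
  fixes A :: "real^'n^'n" and V W :: "real^'m^'n" and Y :: "real^'k^'n" and G :: "real^'k^'k"
    and x0 :: "real^'n"
    and M :: "'a measure" and v :: "'a \<Rightarrow> real^'m" and \<eta> :: "'a \<Rightarrow> real^'k"
    and xstar b xtilde :: "'a \<Rightarrow> real^'n"
    and P :: "'b measure" and x :: "'b \<Rightarrow> real^'n"
  assumes "CARD('m) \<le> CARD('n)"
    and "invertible A"
    and "rank W = CARD('m)" and "rank V = CARD('m)"
    and "det (transpose W ** A ** V) \<noteq> 0"
    and "range (\<lambda>u. Y *v u) = {z. (transpose W ** A) *v z = 0}"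
    and "psd G"
    and "prob_space M"
    and "indep_rvs M v \<eta>"
    and "distr M borel \<eta> = gaussian 0 (mat 1)"
    and "xstar = (\<lambda>\<omega>. x0 + V *v v \<omega> + (Y ** psd_sqrt G) *v \<eta> \<omega>)"
    and "prob_space P"
    and "x \<in> borel_measurable P"
    and "distr P borel x = gaussian x0 (V ** transpose V + Y ** G ** transpose Y)"
    and "b = (\<lambda>\<omega>. A *v xstar \<omega>)"
    and "xtilde = (\<lambda>\<omega>. x0 + (V ** matrix_inv (transpose W ** A ** V) ** transpose W) *v (b \<omega> - A *v x0))"
  shows
    "(let prior_cond = gaussian_cond x0 (V ** transpose V + Y ** G ** transpose Y) (transpose W ** A);
          xstar_cond = (\<lambda>v0. distr M borel (\<lambda>\<omega>. x0 + V *v v0 + (Y ** psd_sqrt G) *v \<eta> \<omega>))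
      in is_cond_distr P x (\<lambda>\<omega>. (transpose W ** A) *v x \<omega>) prior_cond \<and>
         is_cond_distr M xstar v xstar_cond \<and>
         (\<forall>v0. prior_cond (transpose W *v (A *v x0 + (A ** V) *v v0)) = xstar_cond v0)) \<and>
     (rank (Y ** G ** transpose Y) = CARD('n) - CARD('m) \<longrightarrow>
        distr M borel (\<lambda>\<omega>. (xstar \<omega> - xtilde \<omega>) \<bullet> (pinv (Y ** G ** transpose Y) *v (xstar \<omega> - xtilde \<omega>)))
        = chi_squared (CARD('n) - CARD('m)))"
proof -
  define L where "L = Y ** psd_sqrt G"
  define B where "B = transpose W ** A"
  define C where "C = B ** V"
  have \<eta>[measurable]: "\<eta> \<in> borel_measurable M"
    using \<open>indep_rvs M v \<eta>\<close> by (simp add: indep_rvs_def)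
  have law_\<eta>: "distr M borel \<eta> = std_gaussian"
    using assms(10) by (simp add: gaussian_0_1)
  have YGY: "Y ** G ** transpose Y = L ** transpose L"
  proof -
    have "L ** transpose L = Y ** (psd_sqrt G ** psd_sqrt G) ** transpose Y"
      by (simp add: L_def matrix_transpose_mul psd_sqrt_square_symmetric(2)[OF \<open>psd G\<close>] matrix_mul_assoc)
    then show ?thesis by (simp add: psd_sqrt_square_symmetric(1)[OF \<open>psd G\<close>])
  qed
  have "B *v (Y *v u) = 0" for u
    using assms(6) by (auto simp: B_def)
  then have "B ** Y = 0"
    by (simp add: matrix_eq matrix_vector_mul_assoc)
  then have BL: "B ** L = 0"
    by (simp add: L_def matrix_mul_assoc)
  have det: "det (B ** V) \<noteq> 0"
    using assms(5) by (simp add: B_def)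
  have prior: "gaussian_cond x0 (V ** transpose V + L ** transpose L) B (transpose W *v (A *v x0 + (A ** V) *v v0))
      = distr M borel (\<lambda>\<omega>. x0 + V *v v0 + L *v \<eta> \<omega>)" for v0
  proof -
    \<comment> \<open>The deviation of the observation from its mean is
      \<open>(B ** V) *v v0\<close>, which the gain maps to \<open>V *v v0\<close>.\<close>
    have "transpose W *v (A *v x0 + (A ** V) *v v0) - B *v x0 = (B ** V) *v v0"
      by (simp add: B_def matrix_vector_right_distrib matrix_vector_mul_assoc matrix_mul_assoc
          del: transpose_matrix_vector)
    moreover have "(V ** matrix_inv (B ** V)) *v ((B ** V) *v v0) = (V ** (matrix_inv (B ** V) ** (B ** V))) *v v0"
      by (simp only: matrix_vector_mul_assoc matrix_mul_assoc)
    ultimately have "gaussian_cond x0 (V ** transpose V + L ** transpose L) B (transpose W *v (A *v x0 + (A ** V) *v v0))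
        = distr (distr M borel \<eta>) borel (\<lambda>z. x0 + V *v v0 + L *v z)"
      using matrix_inv_mult(2)[OF det] by (simp only: gaussian_cond_eq[OF BL det] law_\<eta>) simp
    then show ?thesis
      by (subst (asm) distr_distr) (auto simp: o_def)
  qed
  have cond_x: "is_cond_distr P x (\<lambda>\<omega>. B *v x \<omega>) (gaussian_cond x0 (V ** transpose V + L ** transpose L) B)"
    using assms(13,14) unfolding YGY by (intro is_cond_distr_gaussian_cond BL det)
  have cond_xstar: "is_cond_distr M xstar v (\<lambda>v0. distr M borel (\<lambda>\<omega>. x0 + V *v v0 + L *v \<eta> \<omega>))"
    unfolding assms(11) L_def[symmetric]
    by (rule is_cond_distr_indep[OF \<open>prob_space M\<close> \<open>indep_rvs M v \<eta>\<close>]) (unfold case_prod_beta', measurable)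
  \<comment> \<open>\<open>V ** matrix_inv (B ** V) ** B\<close> is the oblique projection onto the
    range of \<open>V\<close> along the kernel of \<open>B\<close>: it fixes
    \<open>V *v v \<omega>\<close> and annihilates \<open>L *v \<eta> \<omega>\<close>.\<close>
  have err: "xstar \<omega> - xtilde \<omega> = L *v \<eta> \<omega>" for \<omega>
  proof -
    define D where "D = matrix_inv (B ** V)"
    have "b \<omega> - A *v x0 = A *v (V *v v \<omega> + L *v \<eta> \<omega>)"
      by (simp add: assms(11,15) L_def matrix_vector_right_distrib)
    then have "xtilde \<omega> = x0 + (V ** D ** transpose W) *v (A *v (V *v v \<omega> + L *v \<eta> \<omega>))"
      by (simp add: assms(16) D_def B_def)
    also have "(V ** D ** transpose W) *v (A *v (V *v v \<omega> + L *v \<eta> \<omega>))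
        = (V ** (D ** (B ** V))) *v v \<omega> + (V ** D ** (B ** L)) *v \<eta> \<omega>"
      by (simp only: B_def matrix_vector_mul_assoc matrix_mul_assoc matrix_vector_right_distrib)
    also have "\<dots> = V *v v \<omega>"
      using matrix_inv_mult(2)[OF det] by (simp add: BL D_def)
    finally show ?thesis
      by (simp add: assms(11) L_def)
  qed
  \<comment> \<open>The error has the law of \<open>L *v z\<close> for standard Gaussian
    \<open>z\<close>, so this holds with the rank as degrees of freedom; the rank condition is
    applied only at the end.\<close>
  have chi: "distr M borel (\<lambda>\<omega>. (xstar \<omega> - xtilde \<omega>) \<bullet> (pinv (L ** transpose L) *v (xstar \<omega> - xtilde \<omega>)))
      = chi_squared (rank (L ** transpose L))"
  proof -
    have "distr M borel (\<lambda>\<omega>. (L *v \<eta> \<omega>) \<bullet> (pinv (L ** transpose L) *v (L *v \<eta> \<omega>)))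
        = distr (distr M borel \<eta>) borel (\<lambda>z. (L *v z) \<bullet> (pinv (L ** transpose L) *v (L *v z)))"
      by (subst distr_distr) (auto simp: o_def)
    then show ?thesis by (simp add: err law_\<eta> gaussian_pinv_chi_squared)
  qed
  show ?thesis
    unfolding Let_def YGY B_def[symmetric] L_def[symmetric]
    using cond_x cond_xstar prior chi by simp
qed

end
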